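(* Let $M>0$ and $X=[0,M]$ with periodic boundary conditions. Let $a,b,c,d\in C^\infty(X)$ be (periodic) functions, and let $L$ be the operator $$Lu:=a(x)u_{xxx}+b(x)u_{xx}+c(x)u_x+d(x)u,$$ viewed as an unbounded linear operator on (complex) $L^2(X)$ with domain $H^3(X)$. Suppose $\inf_{x\in X}a(x)=a_0>0$ and $$\bar\delta:=\frac1M\int_0^M\frac{b(y)}{a(y)}\,dy\neq0.$$ Then there is a sequence $\{\lambda_j\}_{j\in\mathbf N}$ of eigenvalues of $L$ such that $$\lim_{j\to\infty}\,-\bar\delta\,\Re(\lambda_j)=+\infty.$$
   Context: $H^3(X)$ is the Sobolev space of $M$-periodic functions with three derivatives in $L^2$. *)

theory Defs
  imports "HOL-Analysis.Analysis"
begin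

text \<open>X = [0,M] with periodic boundary conditions: functions on the real line of period M.\<close>

definition periodic :: "real \<Rightarrow> (real \<Rightarrow> 'b) \<Rightarrow> bool" where
  "periodic M f \<longleftrightarrow> (\<forall>x. f (x + M) = f x)"

definition smooth :: "(real \<Rightarrow> real) \<Rightarrow> bool" where
  "smooth f \<longleftrightarrow> (\<forall>n x. ((deriv ^^ n) f) differentiable (at x))"

definition smooth_periodic :: "real \<Rightarrow> (real \<Rightarrow> real) \<Rightarrow> bool" where
  "smooth_periodic M f \<longleftrightarrow> smooth f \<and> periodic M f"

definition L2_per :: "real \<Rightarrow> (real \<Rightarrow> complex) \<Rightarrow> bool" where
  "L2_per M u \<longleftrightarrow> u \<in> borel_measurable lborel \<and> periodic M u \<and>
     set_integrable lborel {0..M} (\<lambda>x. (cmod (u x))\<^sup>2)"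

text \<open>v is the periodic weak derivative of u (tested against smooth periodic test functions;
  real-valued test functions suffice by linearity).\<close>
definition weak_deriv_per :: "real \<Rightarrow> (real \<Rightarrow> complex) \<Rightarrow> (real \<Rightarrow> complex) \<Rightarrow> bool" where
  "weak_deriv_per M u v \<longleftrightarrow>
     (\<forall>\<phi>. smooth_periodic M \<phi> \<longrightarrow>
        (LINT x:{0..M}|lborel. u x * complex_of_real (deriv \<phi> x))
          = - (LINT x:{0..M}|lborel. v x * complex_of_real (\<phi> x)))"

definition H3_with :: "real \<Rightarrow> (real \<Rightarrow> complex) \<Rightarrow> (real \<Rightarrow> complex) \<Rightarrow>
     (real \<Rightarrow> complex) \<Rightarrow> (real \<Rightarrow> complex) \<Rightarrow> bool" where
  "H3_with M u v1 v2 v3 \<longleftrightarrow> L2_per M u \<and> L2_per M v1 \<and> L2_per M v2 \<and> L2_per M v3 \<and>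
     weak_deriv_per M u v1 \<and> weak_deriv_per M v1 v2 \<and> weak_deriv_per M v2 v3"

definition eigenvalue_L :: "real \<Rightarrow> (real \<Rightarrow> real) \<Rightarrow> (real \<Rightarrow> real) \<Rightarrow> (real \<Rightarrow> real) \<Rightarrow>
     (real \<Rightarrow> real) \<Rightarrow> complex \<Rightarrow> bool" where
  "eigenvalue_L M a b c d lam \<longleftrightarrow>
     (\<exists>u v1 v2 v3. H3_with M u v1 v2 v3 \<and>
        \<not> (AE x in lborel. x \<in> {0..M} \<longrightarrow> u x = 0) \<and>
        (AE x in lborel. x \<in> {0..M} \<longrightarrow>
           complex_of_real (a x) * v3 x + complex_of_real (b x) * v2 x
           + complex_of_real (c x) * v1 x + complex_of_real (d x) * u x = lam * u x))"

end

theory Submission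
  imports Defs
begin

text \<open>
  Put \<open>\<alpha> = a\<^bsup>-1/3\<^esup>\<close> and \<open>\<partial> = (1/\<alpha>) d/dx\<close>, so that \<open>L = \<partial>\<^sup>3 + B \<partial>\<^sup>2 + C \<partial> + d\<close>. A nowhere vanishing
  eigenfunction \<open>u\<close> is sought through its logarithmic derivative: \<open>\<partial>u = P u\<close> turns \<open>L u = \<lambda> u\<close> into a
  second-order Riccati equation for \<open>P\<close>. Write \<open>P = i k + \<beta> + Q\<close> with \<open>\<beta> = (s - B) / 3\<close>, where the constant \<open>s\<close>
  makes the \<open>\<alpha>\<close>-weighted mean of \<open>\<beta>\<close> vanish, and \<open>\<lambda> = (i k)\<^sup>3 - s k\<^sup>2 + \<mu>\<close>. The linear part in \<open>Q\<close> is
  \<open>\<partial>\<^sup>2 + 3 i k \<partial> - 3 k\<^sup>2 = (\<partial> - r\<^sub>1 k) (\<partial> - r\<^sub>2 k)\<close> with \<open>r\<close> equal to \<open>(\<plusminus>\<surd>3 - 3 i) / 2\<close>. As \<open>Re r \<noteq> 0\<close>, each factor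
  is inverted on periodic functions with norm \<open>O(1/k)\<close>, and the nonlinear equation is solved by
  contraction for large \<open>k\<close>. Choosing \<open>\<mu> = O(k)\<close> as the mean of the nonlinearity gives \<open>Q\<close> mean zero, so
  \<open>u\<close> is periodic as soon as \<open>k \<integral>\<alpha> \<in> 2 \<pi> \<nat>\<close>. Finally \<open>\<integral>\<alpha> B = \<integral>b/a\<close>, hence \<open>s\<close> is a positive multiple of
  the mean of \<open>b/a\<close> and \<open>Re \<lambda> = - s k\<^sup>2 + O(k)\<close>.
\<close>

section \<open>Periodic functions on the line\<close>

lemma periodic_of_int:
  assumes "periodic M f"
  shows "f (x + of_int n * M) = f x"
proof -
  have nat: "f (x + of_nat k * M) = f x" for x k
  proof (induction k)
    case (Suc k)
    have "f (x + of_nat (Suc k) * M) = f ((x + of_nat k * M) + M)"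
      by (simp add: algebra_simps)
    then show ?case
      using assms Suc by (simp add: periodic_def)
  qed simp
  show ?thesis
  proof (cases "n \<ge> 0")
    case True
    then show ?thesis using nat[of x "nat n"] by simp
  next
    case False
    then show ?thesis using nat[of "x + of_int n * M" "nat (- n)"] by simp
  qed
qed

text \<open>Subtracting \<open>\<lfloor>x / M\<rfloor>\<close> periods moves \<open>x\<close> into
  the base interval. Bounds and extrema found on the compact \<open>{0..M}\<close> thereby become
  global.\<close>

lemma periodic_shift_into_interval:
  assumes "M > 0"
  obtains y where "y \<in> {0..M}" "\<And>f. periodic M f \<Longrightarrow> f x = f y"
proof
  let ?y = "x + of_int (- \<lfloor>x / M\<rfloor>) * M"
  have "of_int \<lfloor>x / M\<rfloor> * M \<le> x" "x < of_int (\<lfloor>x / M\<rfloor> + 1) * M"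
    using assms floor_correct[of "x / M"] by (simp_all only: pos_le_divide_eq pos_divide_less_eq)
  then show "?y \<in> {0..M}"
    by (simp add: algebra_simps)
  show "f x = f ?y" if "periodic M f" for f :: "real \<Rightarrow> 'b"
    using periodic_of_int[OF that] by metis
qed

lemma periodic_continuous_bounded:
  fixes f :: "real \<Rightarrow> 'a::real_normed_vector"
  assumes "M > 0" "periodic M f" "continuous_on UNIV f"
  obtains B where "\<And>x. norm (f x) \<le> B"
proof -
  have "continuous_on {0..M} (\<lambda>x. norm (f x))"
    by (intro continuous_on_norm continuous_on_subset[OF assms(3)]) auto
  then obtain z where z: "\<And>y. y \<in> {0..M} \<Longrightarrow> norm (f y) \<le> norm (f z)"
    using continuous_attains_sup[of "{0..M}" "\<lambda>x. norm (f x)"] assms(1) by fastforce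
  have "norm (f x) \<le> norm (f z)" for x
    using periodic_shift_into_interval[OF assms(1), of x] assms(2) z by metis
  then show ?thesis using that by blast
qed

lemma continuous_antiderivative:
  fixes f :: "real \<Rightarrow> 'a::banach"
  assumes "continuous_on UNIV f"
  obtains F where "\<And>x. (F has_vector_derivative f x) (at x)"
proof
  \<comment> \<open>One of the two intervals is always empty or a point, so this is the signed
    integral from 0 to \<open>x\<close>.\<close>
  let ?F = "\<lambda>x. integral {0..x} f - integral {x..0} f"
  fix x :: real
  define n where "n = \<bar>x\<bar> + 1"
  have int: "f integrable_on {u..v}" for u v
    by (intro integrable_continuous_real continuous_on_subset[OF assms]) auto
  \<comment> \<open>Moving the base point to \<open>-n\<close> removes the case split on the sign,
    so that differentiation of an integral in its upper limit applies around
    \<open>x\<close>.\<close>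
  have F: "?F y = integral {-n..y} f - integral {-n..0} f" if "y \<in> {-n..n}" for y
  proof (cases "0 \<le> y")
    case True
    then have "integral {-n..0} f + integral {0..y} f = integral {-n..y} f"
      by (intro Henstock_Kurzweil_Integration.integral_combine int) (auto simp: n_def)
    moreover have "integral {y..0} f = 0"
      using True by (cases "y = 0") auto
    ultimately show ?thesis by (auto simp: algebra_simps)
  next
    case False
    then have "integral {-n..y} f + integral {y..0} f = integral {-n..0} f"
      using that by (intro Henstock_Kurzweil_Integration.integral_combine int) auto
    then show ?thesis using False by (auto simp: algebra_simps)
  qed
  have x: "x \<in> {-n<..<n}" by (auto simp: n_def)
  have "((\<lambda>u. integral {-n..u} f - integral {-n..0} f) has_vector_derivative f x - 0) (at x within {-n..n})"
    using x by (intro has_vector_derivative_diff integral_has_vector_derivative has_vector_derivative_const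
        continuous_on_subset[OF assms]) auto
  then have "((\<lambda>u. integral {-n..u} f - integral {-n..0} f) has_vector_derivative f x) (at x)"
    using x by (metis at_within_Icc_at diff_zero greaterThanLessThan_iff)
  then show "(?F has_vector_derivative f x) (at x)"
    by (rule has_vector_derivative_transform_within_open[where S = "{-n<..<n}"]) (use x F in auto)
qed

text \<open>The increment \<open>F (x + M) - F x\<close> has derivative zero, hence keeps its value
  at 0.\<close>

lemma antiderivative_periodic:
  fixes F :: "real \<Rightarrow> 'a::banach"
  assumes F: "\<And>x. (F has_vector_derivative f x) (at x)"
    and "periodic M f" "F M = F 0"
  shows "periodic M F"
proof -
  have "((\<lambda>x. F (x + M) - F x) has_vector_derivative 0) (at x)" for x
  proof -
    have "((F \<circ> (\<lambda>x. x + M)) has_vector_derivative 1 *\<^sub>R f (x + M)) (at x)"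
      by (rule vector_diff_chain_at) (auto intro!: derivative_eq_intros F)
    then have "((\<lambda>x. F (x + M) - F x) has_vector_derivative 1 *\<^sub>R f (x + M) - f x) (at x)"
      unfolding o_def by (intro has_vector_derivative_diff F)
    then show ?thesis using assms(2) by (simp add: periodic_def)
  qed
  then obtain c where c: "\<And>x. F (x + M) - F x = c"
    using has_vector_derivative_zero_constant[of UNIV "\<lambda>x. F (x + M) - F x"] by auto
  then have "c = 0" using c[of 0] assms(3) by simp
  then show ?thesis using c by (simp add: periodic_def)
qed

lemma integral_derivative:
  fixes F :: "real \<Rightarrow> 'a::banach"
  assumes "\<And>x. (F has_vector_derivative f x) (at x)" "M > 0"
  shows "(f has_integral F M - F 0) {0..M}"
  using assms by (intro fundamental_theorem_of_calculus) (auto intro: has_vector_derivative_at_within)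

lemma integral_derivative_periodic:
  fixes F :: "real \<Rightarrow> 'a::banach"
  assumes "\<And>x. (F has_vector_derivative f x) (at x)" "M > 0" "periodic M F"
  shows "(f has_integral 0) {0..M}"
  using integral_derivative[OF assms(1,2)] assms(3) by (simp add: periodic_def) (metis add_0 diff_self)

lemma continuous_on_vector_derivative:
  assumes "\<And>x. (F has_vector_derivative f x) (at x)"
  shows "continuous_on UNIV F"
  using assms has_vector_derivative_continuous continuous_at_imp_continuous_on by blast

section \<open>First-order periodic equations\<close>

text \<open>With \<partial> = (1/\<alpha>) d/dx this says that \<open>y\<close> is a periodic
  solution of (\<partial> - r) y = f; multiplying by \<alpha> avoids the division.\<close>

definition resolvent_sol :: "real \<Rightarrow> (real \<Rightarrow> real) \<Rightarrow> complex \<Rightarrow> (real \<Rightarrow> complex) \<Rightarrow> (real \<Rightarrow> complex) \<Rightarrow> bool" where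
  "resolvent_sol M \<alpha> r f y \<longleftrightarrow> periodic M y \<and>
     (\<forall>x. (y has_vector_derivative of_real (\<alpha> x) * (r * y x + f x)) (at x))"

lemma resolvent_sol_continuous: "resolvent_sol M \<alpha> r f y \<Longrightarrow> continuous_on UNIV y"
  unfolding resolvent_sol_def by (elim conjE) (rule continuous_on_vector_derivative, erule spec)

lemma resolvent_sol_diff:
  assumes "resolvent_sol M \<alpha> r f y" "resolvent_sol M \<alpha> r g z"
  shows "resolvent_sol M \<alpha> r (\<lambda>x. f x - g x) (\<lambda>x. y x - z x)"
  using assms unfolding resolvent_sol_def periodic_def
  by (auto simp: algebra_simps intro!: derivative_eq_intros)

text \<open>At a maximum of \<open>|y|\<^sup>2\<close> the derivative of \<open>y \<bullet> y\<close> vanishes, so \<open>Re r |y|\<^sup>2 = - y \<bullet> f\<close> there.\<close>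
lemma resolvent_sol_bound:
  assumes "M > 0" and pos: "\<And>x. \<alpha> x > 0" and sol: "resolvent_sol M \<alpha> r f y"
    and f: "\<And>x. norm (f x) \<le> B"
  shows "\<bar>Re r\<bar> * norm (y x) \<le> B"
proof -
  have cont: "continuous_on {0..M} (\<lambda>x. norm (y x))"
    using resolvent_sol_continuous[OF sol] continuous_on_subset continuous_on_norm by blast
  obtain m where m: "\<And>t. t \<in> {0..M} \<Longrightarrow> norm (y t) \<le> norm (y m)"
    using continuous_attains_sup[OF _ _ cont] \<open>M > 0\<close> by fastforce
  have per: "periodic M y" and der: "\<And>x. (y has_vector_derivative of_real (\<alpha> x) * (r * y x + f x)) (at x)"
    using sol by (auto simp: resolvent_sol_def)
  \<comment> \<open>By periodicity the maximum over one period is global, so the derivative test is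
    valid even if \<open>m\<close> is an endpoint of \<open>{0..M}\<close>.\<close>
  have max: "norm (y t) \<le> norm (y m)" for t
    using periodic_shift_into_interval[OF \<open>M > 0\<close>, of t] m per by metis
  have "((\<lambda>t. y t \<bullet> y t) has_derivative
      (\<lambda>h. y m \<bullet> (h *\<^sub>R (of_real (\<alpha> m) * (r * y m + f m))) + (h *\<^sub>R (of_real (\<alpha> m) * (r * y m + f m))) \<bullet> y m)) (at m)"
    using der[of m] unfolding has_vector_derivative_def by (rule has_derivative_inner) (use der[of m] in \<open>simp add: has_vector_derivative_def\<close>)
  then have "((\<lambda>t. y t \<bullet> y t) has_real_derivative 2 * (y m \<bullet> (of_real (\<alpha> m) * (r * y m + f m)))) (at m)"
    unfolding has_field_derivative_def
    by (rule has_derivative_eq_rhs) (auto simp: fun_eq_iff inner_commute algebra_simps)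
  then have "2 * (y m \<bullet> (of_real (\<alpha> m) * (r * y m + f m))) = 0"
    by (rule DERIV_local_max[where d = 1]) (auto simp: power2_norm_eq_inner[symmetric] intro!: power_mono max)
  then have "\<alpha> m * (y m \<bullet> (r * y m + f m)) = 0"
    by (simp add: scaleR_conv_of_real[symmetric])
  then have "y m \<bullet> (r * y m + f m) = 0"
    using pos[of m] by simp
  \<comment> \<open>The imaginary part of \<open>r\<close> turns \<open>y m\<close> by a right angle
    and contributes nothing to the real inner product.\<close>
  moreover have "y m \<bullet> (r * y m) = Re r * (norm (y m))\<^sup>2"
    unfolding cmod_power2 inner_complex_def by (simp add: algebra_simps power2_eq_square)
  ultimately have "Re r * (norm (y m))\<^sup>2 = - (y m \<bullet> f m)"
    by (simp add: inner_add_right)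
  then have "\<bar>Re r\<bar> * (norm (y m))\<^sup>2 = \<bar>y m \<bullet> f m\<bar>"
    by (metis abs_minus_cancel abs_mult abs_norm_cancel power_abs)
  also have "\<dots> \<le> norm (y m) * norm (f m)"
    by (rule Cauchy_Schwarz_ineq2)
  also have "\<dots> \<le> norm (y m) * B"
    by (intro mult_left_mono f) auto
  finally have "norm (y m) * (\<bar>Re r\<bar> * norm (y m)) \<le> norm (y m) * B"
    by (simp add: power2_eq_square algebra_simps)
  moreover have "0 \<le> B"
    using f[of 0] norm_ge_zero order_trans by blast
  ultimately have "\<bar>Re r\<bar> * norm (y m) \<le> B"
    by (cases "norm (y m) = 0") auto
  moreover have "\<bar>Re r\<bar> * norm (y x) \<le> \<bar>Re r\<bar> * norm (y m)"
    by (intro mult_left_mono max) auto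
  ultimately show ?thesis by linarith
qed

text \<open>Variation of constants in the variable \<open>G\<close>, an antiderivative of \<alpha>.
  Since \<open>Re r \<noteq> 0\<close>, the integrating factor does not have modulus 1 after one
  period, so the initial value can be adjusted to make the solution periodic.\<close>

lemma resolvent_sol_exists:
  assumes "M > 0" and pos: "\<And>x. \<alpha> x > 0" and \<alpha>: "continuous_on UNIV \<alpha>" "periodic M \<alpha>"
    and f: "continuous_on UNIV f" "periodic M f" and r: "Re r \<noteq> 0"
  shows "\<exists>y. resolvent_sol M \<alpha> r f y"
proof -
  obtain G where G: "\<And>x. (G has_vector_derivative \<alpha> x) (at x)"
    using continuous_antiderivative[OF \<alpha>(1)] by blast
  have "G 0 < G M"
    using \<open>M > 0\<close> by (rule DERIV_pos_imp_increasing) (use G pos in \<open>auto simp: has_real_derivative_iff_has_vector_derivative\<close>)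
  define E where "E c x = exp (c * of_real (G x - G 0))" for c :: complex and x
  have E: "(E c has_vector_derivative of_real (\<alpha> x) * (c * E c x)) (at x)" for c x
  proof -
    have "((\<lambda>x. complex_of_real (G x - G 0)) has_vector_derivative of_real (\<alpha> x)) (at x)"
      by (rule has_vector_derivative_of_real)
        (use has_vector_derivative_diff[OF G[of x] has_vector_derivative_const[of "G 0"]] in \<open>simp add: has_real_derivative_iff_has_vector_derivative\<close>)
    moreover have "((\<lambda>z. exp (c * z)) has_field_derivative c * E c x) (at (complex_of_real (G x - G 0)))"
      by (auto intro!: derivative_eq_intros simp: E_def)
    ultimately have "((\<lambda>z. exp (c * z)) \<circ> (\<lambda>x. complex_of_real (G x - G 0)) has_vector_derivative of_real (\<alpha> x) * (c * E c x)) (at x)"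
      by (rule field_vector_diff_chain_at)
    then show ?thesis by (simp add: E_def[abs_def] o_def)
  qed
  have E0: "E c x \<noteq> 0" for c x by (simp add: E_def)
  have "continuous_on UNIV (E r)" by (rule continuous_on_vector_derivative[OF E])
  then have "continuous_on UNIV (\<lambda>x. of_real (\<alpha> x) * f x / E r x)"
    using E0 by (intro continuous_intros \<alpha> f) auto
  then obtain H where H: "\<And>x. (H has_vector_derivative of_real (\<alpha> x) * f x / E r x) (at x)"
    using continuous_antiderivative by blast
  have "norm (E r M) \<noteq> 1"
    using r \<open>G 0 < G M\<close> by (simp add: E_def)
  then have E1: "1 - E r M \<noteq> 0" by auto
  \<comment> \<open>\<open>C\<close> is the initial value \<open>y 0\<close>, obtained by solving
    \<open>E r M * (C + H M - H 0) = C\<close>.\<close>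
  define C where "C = E r M * (H M - H 0) / (1 - E r M)"
  define y where "y x = E r x * (C + H x - H 0)" for x
  have der: "(y has_vector_derivative of_real (\<alpha> x) * (r * y x + f x)) (at x)" for x
  proof -
    have "((\<lambda>x. C + H x - H 0) has_vector_derivative 0 + of_real (\<alpha> x) * f x / E r x - 0) (at x)"
      by (intro has_vector_derivative_diff has_vector_derivative_add H has_vector_derivative_const)
    from has_vector_derivative_mult[OF E[of r x] this] show ?thesis
      unfolding y_def[abs_def] using E0[of r x]
      by (elim has_vector_derivative_eq_rhs) (simp add: field_simps)
  qed
  have "E r 0 = 1" by (simp add: E_def)
  have "y M = y 0"
    using E1 unfolding y_def C_def \<open>E r 0 = 1\<close> by (simp add: divide_simps) (simp add: algebra_simps)
  \<comment> \<open>The increment over a period solves the homogeneous equation; the factor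
    \<open>E (- r)\<close> turns it into a constant, which vanishes because
    \<open>y M = y 0\<close>.\<close>
  define w where "w x = (y (x + M) - y x) * E (- r) x" for x
  have "(w has_vector_derivative 0) (at x)" for x
  proof -
    have "(y \<circ> (\<lambda>x. x + M) has_vector_derivative 1 *\<^sub>R (of_real (\<alpha> (x + M)) * (r * y (x + M) + f (x + M)))) (at x)"
      by (rule vector_diff_chain_at) (auto intro!: derivative_eq_intros der)
    then have "((\<lambda>x. y (x + M) - y x) has_vector_derivative of_real (\<alpha> x) * (r * (y (x + M) - y x))) (at x)"
      unfolding o_def using \<alpha>(2)[unfolded periodic_def, rule_format, of x] f(2)[unfolded periodic_def, rule_format, of x]
      by (intro has_vector_derivative_diff[THEN has_vector_derivative_eq_rhs, OF _ der[of x]])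
        (simp_all add: algebra_simps)
    from has_vector_derivative_mult[OF this E[of "- r" x]] show ?thesis
      unfolding w_def[abs_def] by (elim has_vector_derivative_eq_rhs) (simp add: algebra_simps)
  qed
  then obtain c where "\<And>x. w x = c"
    using has_vector_derivative_zero_constant[of UNIV w] by auto
  moreover have "w 0 = 0" using \<open>y M = y 0\<close> by (simp add: w_def)
  ultimately have "w x = 0" for x by metis
  then have "periodic M y"
    using E0 by (simp add: w_def periodic_def)
  then show ?thesis
    using der by (auto simp: resolvent_sol_def)
qed

section \<open>Contraction principle for continuous periodic functions\<close>

definition adm :: "real \<Rightarrow> real \<Rightarrow> (real \<Rightarrow> complex) \<Rightarrow> bool" where
  "adm M R z \<longleftrightarrow> continuous_on UNIV z \<and> periodic M z \<and> (\<forall>x. norm (z x) \<le> R)"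

lemma continuous_on_apply_bcontfun_arg:
  "continuous_on UNIV (\<lambda>z :: real \<Rightarrow>\<^sub>C complex. apply_bcontfun z x)"
  unfolding continuous_on_iff using dist_bounded le_less_trans by blast

text \<open>Banach's theorem on the closed ball of radius \<open>R\<close> in the sup norm. It is
  phrased for plain functions, a uniform bound \<open>e\<close> replacing the distance; the proof
  transports it to the complete space of bounded continuous functions.\<close>

lemma adm_contraction_fixpoint:
  assumes R: "0 \<le> R"
    and maps: "\<And>z. adm M R z \<Longrightarrow> adm M R (T z)"
    and contr: "\<And>z w e x. adm M R z \<Longrightarrow> adm M R w \<Longrightarrow> (\<And>x. norm (z x - w x) \<le> e) \<Longrightarrow>
                  norm (T z x - T w x) \<le> e / 2"
  shows "\<exists>z. adm M R z \<and> T z = z"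
proof -
  define S where "S = {z :: real \<Rightarrow>\<^sub>C complex. adm M R (apply_bcontfun z)}"
  \<comment> \<open>Each condition concerns point evaluations, which are continuous, so
    \<open>S\<close> is an intersection of closed sets.\<close>
  have S_eq: "S = (\<Inter>x. {z. apply_bcontfun z (x + M) = apply_bcontfun z x}) \<inter> (\<Inter>x. {z. norm (apply_bcontfun z x) \<le> R})"
    by (auto simp: S_def adm_def periodic_def)
  have "closed S" unfolding S_eq
    by (intro closed_Int closed_INT ballI closed_Collect_eq closed_Collect_le continuous_on_norm
        continuous_on_apply_bcontfun_arg continuous_on_const)
  then have "complete S" by (simp add: complete_eq_closed)
  define T' where "T' z = Bcontfun (T (apply_bcontfun z))" for z
  have inv: "apply_bcontfun (Bcontfun z) = z" if "adm M R z" for z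
    using that by (intro Bcontfun_inverse bcontfun_normI) (auto simp: adm_def)
  have T': "apply_bcontfun (T' z) = T (apply_bcontfun z)" if "z \<in> S" for z
    using that maps by (auto simp: S_def T'_def intro!: inv)
  have "0 \<in> S" using R by (auto simp: S_def adm_def periodic_def)
  have "\<exists>!z\<in>S. T' z = z"
  proof (rule Banach_fix)
    show "complete S" by fact
    show "S \<noteq> {}" using \<open>0 \<in> S\<close> by auto
    show "T' ` S \<subseteq> S" using T' maps by (auto simp: S_def)
    show "dist (T' z) (T' w) \<le> 1 / 2 * dist z w" if "z \<in> S" "w \<in> S" for z w
    proof (rule dist_bound)
      fix x
      have "norm (T (apply_bcontfun z) x - T (apply_bcontfun w) x) \<le> dist z w / 2"
        using that dist_bounded[of z _ w] by (intro contr) (auto simp: S_def dist_norm)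
      then show "dist (apply_bcontfun (T' z) x) (apply_bcontfun (T' w) x) \<le> 1 / 2 * dist z w"
        using that by (simp add: T' dist_norm)
    qed
  qed auto
  then obtain z where "z \<in> S" "T' z = z" by blast
  then show ?thesis using T' by (metis S_def mem_Collect_eq)
qed

section \<open>Resolvents and means on the circle with weight \<alpha>\<close>

locale weighted_circle =
  fixes M :: real and \<alpha> :: "real \<Rightarrow> real"
  assumes M_pos: "M > 0" and \<alpha>_cont: "continuous_on UNIV \<alpha>"
    and \<alpha>_per: "periodic M \<alpha>" and \<alpha>_pos: "\<And>x. \<alpha> x > 0"
begin

definition percont :: "(real \<Rightarrow> complex) \<Rightarrow> bool" where
  "percont f \<longleftrightarrow> continuous_on UNIV f \<and> periodic M f"

lemma percont_ops:
  "percont (\<lambda>x. c)"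
  "percont f \<Longrightarrow> percont g \<Longrightarrow> percont (\<lambda>x. f x + g x)"
  "percont f \<Longrightarrow> percont g \<Longrightarrow> percont (\<lambda>x. f x - g x)"
  "percont f \<Longrightarrow> percont g \<Longrightarrow> percont (\<lambda>x. f x * g x)"
  "percont f \<Longrightarrow> percont (\<lambda>x. f x ^ n)"
  unfolding percont_def periodic_def
  by (simp_all add: continuous_on_add continuous_on_diff continuous_on_mult continuous_on_power)

lemma adm_percont: "adm M R z \<Longrightarrow> percont z"
  by (auto simp: adm_def percont_def)

text \<open>A solution picked by choice; \<open>resolvent_sol_bound\<close> and
  \<open>resolvent_sol_diff\<close> speak of arbitrary solutions and so apply to it.\<close>

definition res :: "complex \<Rightarrow> (real \<Rightarrow> complex) \<Rightarrow> real \<Rightarrow> complex" where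
  "res r f = (SOME y. resolvent_sol M \<alpha> r f y)"

lemma res_sol: "percont f \<Longrightarrow> Re r \<noteq> 0 \<Longrightarrow> resolvent_sol M \<alpha> r f (res r f)"
  unfolding res_def percont_def
  by (rule someI_ex[of "resolvent_sol M \<alpha> r f"], rule resolvent_sol_exists)
    (simp_all add: M_pos \<alpha>_pos \<alpha>_cont \<alpha>_per)

lemma resolvent_sol_percont: "resolvent_sol M \<alpha> r f y \<Longrightarrow> percont y"
  unfolding percont_def by (intro conjI, erule resolvent_sol_continuous) (simp add: resolvent_sol_def)

lemma res_percont: "percont f \<Longrightarrow> Re r \<noteq> 0 \<Longrightarrow> percont (res r f)"
  using res_sol resolvent_sol_percont by blast

lemma res_bound:
  assumes "percont f" "Re r \<noteq> 0" "\<And>x. norm (f x) \<le> B"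
  shows "\<bar>Re r\<bar> * norm (res r f x) \<le> B"
  by (rule resolvent_sol_bound[OF M_pos \<alpha>_pos res_sol[OF assms(1,2)] assms(3)])

lemma res_diff_bound:
  assumes "percont f" "percont g" "Re r \<noteq> 0" "\<And>x. norm (f x - g x) \<le> B"
  shows "\<bar>Re r\<bar> * norm (res r f x - res r g x) \<le> B"
  by (rule resolvent_sol_bound[OF M_pos \<alpha>_pos resolvent_sol_diff[OF res_sol[OF assms(1,3)] res_sol[OF assms(2,3)]] assms(4)])

text \<open>The mean with respect to \<alpha> dx, the measure for which \<partial> of a periodic
  function has mean zero.\<close>

definition wmean :: "(real \<Rightarrow> complex) \<Rightarrow> complex" where
  "wmean f = integral {0..M} (\<lambda>x. of_real (\<alpha> x) * f x) / of_real (integral {0..M} \<alpha>)"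

lemma \<alpha>_int: "\<alpha> integrable_on {0..M}"
  by (intro integrable_continuous_real continuous_on_subset[OF \<alpha>_cont]) auto

lemma weighted_int:
  assumes "percont f"
  shows "(\<lambda>x. of_real (\<alpha> x) * f x) integrable_on {0..M}"
proof -
  have "continuous_on UNIV (\<lambda>x. of_real (\<alpha> x) * f x)"
    using assms \<alpha>_cont by (simp add: percont_def continuous_on_mult continuous_on_of_real)
  then show ?thesis
    by (meson integrable_continuous_real continuous_on_subset subset_UNIV)
qed

lemma integral_\<alpha>_pos: "integral {0..M} \<alpha> > 0"
proof -
  obtain G where G: "\<And>x. (G has_vector_derivative \<alpha> x) (at x)"
    using continuous_antiderivative[OF \<alpha>_cont] by blast
  have "G 0 < G M"
    using M_pos by (rule DERIV_pos_imp_increasing)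
      (use G \<alpha>_pos in \<open>auto simp: has_real_derivative_iff_has_vector_derivative\<close>)
  then show ?thesis
    using integral_unique[OF integral_derivative[OF G M_pos]] by simp
qed

lemma wmean_const: "wmean (\<lambda>x. c) = c"
proof -
  have "integral {0..M} (\<lambda>x. complex_of_real (\<alpha> x)) = of_real (integral {0..M} \<alpha>)"
    using has_integral_of_real[OF integrable_integral[OF \<alpha>_int]] by (rule integral_unique)
  then show ?thesis
    using integral_\<alpha>_pos by (simp add: wmean_def)
qed

lemma wmean_diff: "percont f \<Longrightarrow> percont g \<Longrightarrow> wmean (\<lambda>x. f x - g x) = wmean f - wmean g"
  by (simp add: wmean_def right_diff_distrib Henstock_Kurzweil_Integration.integral_diff weighted_int diff_divide_distrib)

lemma wmean_bound:
  assumes "percont f" "\<And>x. norm (f x) \<le> B"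
  shows "norm (wmean f) \<le> B"
proof -
  have "norm (integral {0..M} (\<lambda>x. of_real (\<alpha> x) * f x)) \<le> integral {0..M} (\<lambda>x. \<alpha> x * B)"
    using \<alpha>_pos assms(2)
    by (intro Henstock_Kurzweil_Integration.integral_norm_bound_integral weighted_int assms(1) integrable_on_mult_left \<alpha>_int)
      (auto simp: norm_mult abs_of_pos intro!: mult_left_mono less_imp_le)
  then show ?thesis
    using integral_\<alpha>_pos by (simp add: wmean_def norm_divide field_simps)
qed

text \<open>The derivative of the periodic \<open>y\<close> integrates to zero, so \<open>r\<close>
  times the mean of \<open>y\<close> is minus the mean of \<open>f\<close>.\<close>

lemma wmean_resolvent_sol:
  assumes "resolvent_sol M \<alpha> r f y" "percont f" "r \<noteq> 0" "wmean f = 0"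
  shows "wmean y = 0"
proof -
  have y: "percont y" using assms(1) by (rule resolvent_sol_percont)
  have "((\<lambda>x. of_real (\<alpha> x) * (r * y x + f x)) has_integral 0) {0..M}"
    using assms(1) M_pos by (intro integral_derivative_periodic[of y]) (auto simp: resolvent_sol_def)
  moreover have "((\<lambda>x. r * (of_real (\<alpha> x) * y x) + of_real (\<alpha> x) * f x) has_integral
      r * integral {0..M} (\<lambda>x. of_real (\<alpha> x) * y x) + integral {0..M} (\<lambda>x. of_real (\<alpha> x) * f x)) {0..M}"
    by (intro has_integral_add has_integral_mult_right integrable_integral weighted_int y assms)
  then have "((\<lambda>x. of_real (\<alpha> x) * (r * y x + f x)) has_integral
      r * integral {0..M} (\<lambda>x. of_real (\<alpha> x) * y x) + integral {0..M} (\<lambda>x. of_real (\<alpha> x) * f x)) {0..M}"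
    by (simp add: algebra_simps)
  ultimately have "r * integral {0..M} (\<lambda>x. of_real (\<alpha> x) * y x) + integral {0..M} (\<lambda>x. of_real (\<alpha> x) * f x) = 0"
    using has_integral_unique by blast
  then show ?thesis
    using assms(3,4) integral_\<alpha>_pos by (auto simp: wmean_def)
qed

end

section \<open>The nonlinear periodic problem\<close>

text \<open>The Riccati equation is \<open>(\<partial> - r\<^sub>1 k) (\<partial> - r\<^sub>2 k) Q = \<mu> - nonlin\<close>, the arguments \<open>q\<close> and \<open>w\<close> standing
  for \<open>Q\<close> and \<open>\<partial>Q\<close>. The coefficients \<open>A0\<close> and \<open>A1\<close> are \<open>O(k)\<close>.\<close>
definition nonlin :: "real \<Rightarrow> real \<Rightarrow> complex \<Rightarrow> complex \<Rightarrow> complex \<Rightarrow> complex \<Rightarrow> complex" where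
  "nonlin s k A0 A1 q w = A0 + A1 * q + of_real s * w + 3 * q * w + (3 * \<i> * of_real k + of_real s) * q^2 + q^3"

text \<open>The hypotheses are the bounds available when Z stays in the ball of radius
  \<open>R\<close> and two choices of Z differ by at most \<open>e\<close>. The resulting constant
  does not involve \<open>k\<close>: the growth of \<open>A1\<close> and of
  \<open>3 * \<i> * of_real k\<close> is absorbed by the factors \<open>1 / k\<close> carried by
  \<open>q\<close>, \<open>q'\<close> and their difference.\<close>

lemma nonlin_lipschitz:
  assumes k: "k \<ge> 1" and R: "R \<ge> 0" and A1: "norm A1 \<le> K * k"
    and q: "norm q \<le> 2 * R / k" "norm q' \<le> 2 * R / k" "norm (q - q') \<le> 2 * e / k"
    and w: "norm w' \<le> 5 * R" "norm (w - w') \<le> 5 * e"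
  shows "norm (nonlin s k A0 A1 q w - nonlin s k A0 A1 q' w')
          \<le> (2 * K + 5 * \<bar>s\<bar> + 84 * R + 8 * R * \<bar>s\<bar> + 24 * R^2) * e"
proof -
  have e: "e \<ge> 0" using order_trans[OF norm_ge_zero w(2)] by simp
  have k0: "k > 0" and k1: "1 / k \<le> 1" using k by auto
  have Rk: "R / k \<le> R" and ek: "e / k \<le> e"
    using mult_left_mono[OF k1 R] mult_left_mono[OF k1 e] by auto
  have Rk0: "0 \<le> R / k" and ek0: "0 \<le> e / k" using R e k0 by auto
  \<comment> \<open>Every summand on the right carries a factor \<open>q - q'\<close> or
    \<open>w - w'\<close>; the six are estimated one by one below.\<close>
  have "nonlin s k A0 A1 q w - nonlin s k A0 A1 q' w' =
      A1 * (q - q') + of_real s * (w - w') + 3 * (q * (w - w')) + 3 * ((q - q') * w')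
      + (3 * \<i> * of_real k + of_real s) * ((q + q') * (q - q')) + (q * q + q * q' + q' * q') * (q - q')"
    unfolding nonlin_def by (simp add: algebra_simps power2_eq_square power3_eq_cube)
  also have "norm \<dots> \<le> norm (A1 * (q - q')) + norm (of_real s * (w - w')) + norm (3 * (q * (w - w')))
      + norm (3 * ((q - q') * w')) + norm ((3 * \<i> * of_real k + of_real s) * ((q + q') * (q - q')))
      + norm ((q * q + q * q' + q' * q') * (q - q'))"
    by (intro order_trans[OF norm_triangle_ineq] add_mono order_refl)
  also have "\<dots> \<le> 2 * K * e + 5 * \<bar>s\<bar> * e + 30 * R * e + 30 * R * e + (24 * R * e + 8 * R * \<bar>s\<bar> * e) + 24 * R^2 * e"
  proof (intro add_mono)
    have "norm (A1 * (q - q')) \<le> (K * k) * (2 * e / k)"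
      unfolding norm_mult by (intro mult_mono A1 q) (use order_trans[OF norm_ge_zero A1] in auto)
    then show "norm (A1 * (q - q')) \<le> 2 * K * e" using k0 by simp
    show "norm (of_real s * (w - w')) \<le> 5 * \<bar>s\<bar> * e"
      using mult_left_mono[OF w(2), of "\<bar>s\<bar>"] by (simp add: norm_mult)
    have "norm (q * (w - w')) \<le> (2 * (R / k)) * (5 * e)"
      unfolding norm_mult using q w Rk0 e by (intro mult_mono) auto
    also have "\<dots> \<le> (2 * R) * (5 * e)" using Rk e by (intro mult_right_mono) auto
    finally show "norm (3 * (q * (w - w'))) \<le> 30 * R * e" by (simp add: norm_mult)
    have "norm ((q - q') * w') \<le> (2 * (e / k)) * (5 * R)"
      unfolding norm_mult using q w ek0 by (intro mult_mono) auto
    also have "\<dots> \<le> (2 * e) * (5 * R)" using ek R by (intro mult_right_mono) auto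
    finally show "norm (3 * ((q - q') * w')) \<le> 30 * R * e" 
      unfolding norm_mult[of 3] by (simp add: algebra_simps)
    have "norm (3 * \<i> * of_real k + of_real s) \<le> 3 * k + \<bar>s\<bar>"
      using norm_triangle_ineq[of "3 * \<i> * of_real k" "of_real s"] k0 by (simp add: norm_mult)
    moreover have "norm ((q + q') * (q - q')) \<le> (4 * (R / k)) * (2 * (e / k))"
      unfolding norm_mult using q Rk0 norm_triangle_ineq[of q q'] by (intro mult_mono) auto
    ultimately have "norm ((3 * \<i> * of_real k + of_real s) * ((q + q') * (q - q')))
        \<le> (3 * k + \<bar>s\<bar>) * ((4 * (R / k)) * (2 * (e / k)))"
      unfolding norm_mult[of "3 * \<i> * of_real k + of_real s"] using k0 by (intro mult_mono) auto
    also have "\<dots> = 24 * R * (e / k) + 8 * \<bar>s\<bar> * ((R / k) * (e / k))"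
      using k0 by (simp add: field_simps)
    also have "\<dots> \<le> 24 * R * e + 8 * \<bar>s\<bar> * (R * e)"
      using Rk ek Rk0 ek0 R e by (intro add_mono mult_left_mono mult_mono) auto
    finally show "norm ((3 * \<i> * of_real k + of_real s) * ((q + q') * (q - q'))) \<le> 24 * R * e + 8 * R * \<bar>s\<bar> * e"
      by (simp add: algebra_simps)
    have q2: "norm q \<le> 2 * R" "norm q' \<le> 2 * R" using q Rk by auto
    have "norm (q * q + q * q' + q' * q') \<le> norm (q * q) + norm (q * q') + norm (q' * q')"
      by (intro order_trans[OF norm_triangle_ineq] add_mono order_refl)
    also have "\<dots> \<le> (2 * R) * (2 * R) + (2 * R) * (2 * R) + (2 * R) * (2 * R)"
      unfolding norm_mult using q2 R by (intro add_mono mult_mono) auto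
    finally have "norm ((q * q + q * q' + q' * q') * (q - q')) \<le> (12 * R^2) * (2 * e)"
      unfolding norm_mult[of "q * q + q * q' + q' * q'"] using q ek
      by (intro mult_mono) (auto simp: power2_eq_square)
    then show "norm ((q * q + q * q' + q' * q') * (q - q')) \<le> 24 * R^2 * e" by simp
  qed
  finally show ?thesis by (simp add: algebra_simps)
qed

text \<open>\<open>root1\<close> and \<open>root2\<close> are the zeros of
  \<open>r^2 + 3 * \<i> * r - 3\<close>, the symbol of the linear part at
  \<open>k = 1\<close>.\<close>

definition root1 :: complex where "root1 = Complex (sqrt 3 / 2) (- 3 / 2)"
definition root2 :: complex where "root2 = Complex (- sqrt 3 / 2) (- 3 / 2)"

lemma root_sum: "root1 + root2 = - 3 * \<i>" and root_prod: "root1 * root2 = - 3"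
  by (auto simp: root1_def root2_def complex_eq_iff)

lemma norm_root2: "norm root2 \<le> 2"
proof -
  have "(norm root2)^2 \<le> 2^2" unfolding cmod_power2 by (simp add: root2_def power_divide)
  then show ?thesis by (rule power2_le_imp_le) simp
qed

lemma Re_roots:
  assumes "k \<ge> 1"
  shows "\<bar>Re (root1 * of_real k)\<bar> \<ge> k / 2" "\<bar>Re (root2 * of_real k)\<bar> \<ge> k / 2"
proof -
  have "1 \<le> sqrt 3" by simp
  then have "k * 1 \<le> k * sqrt 3" using assms by (intro mult_left_mono) auto
  then show "\<bar>Re (root1 * of_real k)\<bar> \<ge> k / 2" "\<bar>Re (root2 * of_real k)\<bar> \<ge> k / 2"
    using assms by (auto simp: root1_def root2_def abs_mult algebra_simps)
qed

context weighted_circle begin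

text \<open>The unknown of the contraction is \<open>Z = \<partial>Q - r\<^sub>2 k Q\<close>, of size \<open>O(1)\<close>; then \<open>Q = O(1/k)\<close> and \<open>\<partial>Q = O(1)\<close>.\<close>
lemma riccati_solution:
  fixes K k s :: real
  defines "R \<equiv> 8 * K"
  defines "c \<equiv> 2 * K + 5 * \<bar>s\<bar> + 84 * R + 8 * R * \<bar>s\<bar> + 24 * R^2"
  assumes k: "k \<ge> 1" "k \<ge> 8 * c" and A: "percont A0" "percont A1"
    and A0: "\<And>x. norm (A0 x) \<le> K * k" and A1: "\<And>x. norm (A1 x) \<le> K * k"
  obtains Q Z \<mu> where
    "resolvent_sol M \<alpha> (root2 * of_real k) Z Q"
    "resolvent_sol M \<alpha> (root1 * of_real k)
       (\<lambda>x. \<mu> - nonlin s k (A0 x) (A1 x) (Q x) (Z x + root2 * of_real k * Q x)) Z"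
    "wmean Q = 0" "norm \<mu> \<le> 9 * K * k"
proof -
  have "0 \<le> K * k" using A0[of 0] norm_ge_zero order_trans by blast
  then have K: "K \<ge> 0" using k by (simp add: zero_le_mult_iff)
  then have R: "R \<ge> 0" and c: "c \<ge> 0" by (auto simp: R_def c_def)
  let ?r1 = "root1 * of_real k" and ?r2 = "root2 * of_real k"
  have re1: "\<bar>Re ?r1\<bar> \<ge> k / 2" and re2: "\<bar>Re ?r2\<bar> \<ge> k / 2" by (rule Re_roots[OF k(1)])+
  have re0: "Re ?r1 \<noteq> 0" "Re ?r2 \<noteq> 0" using re1 re2 k by auto
  \<comment> \<open>Both resolvents gain a factor \<open>2 / k\<close> from the lower bound
    \<open>k / 2\<close> on the real parts.\<close>
  have scale: "norm y \<le> 2 * B / k" if "\<bar>\<rho>\<bar> * norm y \<le> B" "\<bar>\<rho>\<bar> \<ge> k / 2" for y :: complex and \<rho> B :: real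
  proof -
    have "k / 2 * norm y \<le> B" using that mult_right_mono[OF that(2), of "norm y"] by simp
    then show ?thesis using k by (simp add: field_simps)
  qed
  define S where "S = res ?r2"
  define N where "N z x = nonlin s k (A0 x) (A1 x) (S z x) (z x + ?r2 * S z x)" for z x
  \<comment> \<open>\<open>S\<close> inverts the second factor and \<open>T\<close> the first.
    Subtracting the mean of \<open>N z\<close> builds the choice of \<mu> into the fixed-point
    equation.\<close>
  define T where "T z = res ?r1 (\<lambda>x. wmean (N z) - N z x)" for z
  have S_pc: "percont (S z)" if "percont z" for z
    unfolding S_def using that re0(2) by (rule res_percont)
  have N_pc: "percont (N z)" if "percont z" for z
    unfolding N_def[abs_def] nonlin_def using S_pc[OF that] that A by (intro percont_ops) auto
  have F_pc: "percont (\<lambda>x. wmean (N z) - N z x)" if "percont z" for z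
    using N_pc[OF that] by (intro percont_ops)
  \<comment> \<open>The constant is 5 = 1 + 4, as the modulus of \<open>?r2\<close> is at most
    \<open>2 * k\<close>.\<close>
  have lin: "norm (a + ?r2 * b) \<le> 5 * B" if "norm a \<le> B" "norm b \<le> 2 * B / k" for a b B
  proof -
    have "norm (?r2 * b) \<le> (2 * k) * (2 * B / k)"
      unfolding norm_mult using norm_root2 k that by (intro mult_mono) auto
    then show ?thesis using k that norm_triangle_ineq[of a "?r2 * b"] by simp
  qed
  have S_bound: "norm (S z x) \<le> 2 * R / k" if "adm M R z" for z x
    unfolding S_def using that
    by (intro scale[OF res_bound re2] adm_percont re0) (auto simp: adm_def)
  have N_lip: "norm (N z x - N w x) \<le> c * e"
    if z: "adm M R z" and w: "adm M R w" and e: "\<And>x. norm (z x - w x) \<le> e" for z w e x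
    unfolding N_def c_def
  proof (rule nonlin_lipschitz[OF k(1) R A1 S_bound[OF z] S_bound[OF w]])
    show *: "norm (S z x - S w x) \<le> 2 * e / k"
      unfolding S_def using e z w by (intro scale[OF res_diff_bound re2] adm_percont re0) auto
    show "norm (w x + ?r2 * S w x) \<le> 5 * R"
      using w S_bound[OF w] by (intro lin) (auto simp: adm_def)
    have "norm ((z x - w x) + ?r2 * (S z x - S w x)) \<le> 5 * e"
      using e * by (intro lin)
    then show "norm (z x + ?r2 * S z x - (w x + ?r2 * S w x)) \<le> 5 * e"
      by (simp add: algebra_simps)
  qed
  have contr: "norm (T z x - T w x) \<le> e / 2"
    if z: "adm M R z" and w: "adm M R w" and e: "\<And>x. norm (z x - w x) \<le> e" for z w e x
  proof -
    have pc: "percont z" "percont w" using z w adm_percont by auto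
    have "e \<ge> 0" using order_trans[OF norm_ge_zero e] .
    have "norm (wmean (\<lambda>x. N z x - N w x)) \<le> c * e"
      using N_lip[OF z w e] N_pc pc by (intro wmean_bound percont_ops)
    then have mean: "norm (wmean (N z) - wmean (N w)) \<le> c * e"
      using wmean_diff N_pc pc by simp
    have "norm ((wmean (N z) - N z x) - (wmean (N w) - N w x)) \<le> 2 * (c * e)" for x
    proof -
      have "norm ((wmean (N z) - wmean (N w)) - (N z x - N w x)) \<le> c * e + c * e"
        by (intro order_trans[OF norm_triangle_ineq4] add_mono mean N_lip z w e)
      then show ?thesis by (simp add: algebra_simps)
    qed
    \<comment> \<open>Subtracting the mean cost a factor 2 and the resolvent brings
      \<open>2 / k\<close>; the total \<open>4 * c / k\<close> is at most 1/2 by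
      \<open>k \<ge> 8 * c\<close>.\<close>
    then have "norm (T z x - T w x) \<le> 2 * (2 * (c * e)) / k"
      unfolding T_def by (intro scale[OF res_diff_bound re1] F_pc pc re0)
    also have "\<dots> \<le> e / 2"
      using k \<open>e \<ge> 0\<close> mult_right_mono[OF k(2) \<open>e \<ge> 0\<close>] by (simp add: field_simps)
    finally show ?thesis .
  qed
  have adm0: "adm M R (\<lambda>x. 0)" using R by (auto simp: adm_def periodic_def)
  have S0: "S (\<lambda>x. 0) x = 0" for x
  proof -
    have "norm (S (\<lambda>x. 0) x) \<le> 2 * 0 / k"
      unfolding S_def by (intro scale[OF res_bound re2] percont_ops re0) auto
    then show ?thesis by simp
  qed
  have N0: "N (\<lambda>x. 0) = A0"
    by (auto simp: N_def nonlin_def S0)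
  \<comment> \<open>This fixes \<open>R = 8 * K\<close>: the image of 0 has size at most
    \<open>4 * K\<close>, half the radius, and the contraction adds at most the other half.\<close>
  have T0: "norm (T (\<lambda>x. 0) x) \<le> R / 2" for x
  proof -
    have "norm (wmean A0 - A0 x) \<le> 2 * (K * k)" for x
      using norm_triangle_ineq4[of "wmean A0" "A0 x"] wmean_bound[OF A(1) A0] A0[of x] by simp
    then have "norm (T (\<lambda>x. 0) x) \<le> 2 * (2 * (K * k)) / k"
      unfolding T_def N0 by (intro scale[OF res_bound re1] percont_ops A re0)
    then show ?thesis using k by (simp add: R_def)
  qed
  have maps: "adm M R (T z)" if z: "adm M R z" for z
  proof -
    have "percont (T z)"
      unfolding T_def by (intro res_percont F_pc adm_percont[OF z] re0)
    moreover have "norm (T z x) \<le> R" for x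
    proof -
      have "norm (T z x - T (\<lambda>x. 0) x) \<le> R / 2"
        using z adm0 by (intro contr) (auto simp: adm_def)
      then show ?thesis using T0[of x] norm_triangle_sub[of "T z x" "T (\<lambda>x. 0) x"] by simp
    qed
    ultimately show ?thesis by (auto simp: adm_def percont_def)
  qed
  have "\<exists>z. adm M R z \<and> T z = z"
    by (rule adm_contraction_fixpoint[OF R], erule maps, rule contr)
  then obtain Z where Z: "adm M R Z" "T Z = Z" by blast
  have pc: "percont Z" using Z adm_percont by blast
  have sol2: "resolvent_sol M \<alpha> ?r2 Z (S Z)"
    unfolding S_def by (intro res_sol pc re0)
  have sol1: "resolvent_sol M \<alpha> ?r1 (\<lambda>x. wmean (N Z) - N Z x) Z"
    using res_sol[OF F_pc[OF pc] re0(1)] Z(2) unfolding T_def by simp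
  \<comment> \<open>The right-hand side has mean zero, a property that passes through both
    resolvents to \<open>Z\<close> and then to \<open>S Z\<close>.\<close>
  have "wmean (\<lambda>x. wmean (N Z) - N Z x) = 0"
    using wmean_diff[OF percont_ops(1) N_pc[OF pc]] wmean_const by simp
  then have "wmean Z = 0"
    using wmean_resolvent_sol[OF sol1 F_pc[OF pc]] re0 by fastforce
  then have "wmean (S Z) = 0"
    using wmean_resolvent_sol[OF sol2 pc] re0 by fastforce
  \<comment> \<open>The 9 is 1 from \<open>A0\<close> plus 8 from
    \<open>c * R \<le> k * R\<close>.\<close>
  have "norm (N Z x) \<le> 9 * K * k" for x
  proof -
    have "norm (N Z x - N (\<lambda>x. 0) x) \<le> c * R"
      using Z adm0 by (intro N_lip) (auto simp: adm_def)
    also have "\<dots> \<le> k * R" using k c R by (intro mult_right_mono) auto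
    finally show ?thesis
      using A0[of x] norm_triangle_sub[of "N Z x" "A0 x"] by (simp add: N0 R_def algebra_simps)
  qed
  then have "norm (wmean (N Z)) \<le> 9 * K * k"
    by (intro wmean_bound N_pc pc)
  then show ?thesis
    using that[OF sol2 _ \<open>wmean (S Z) = 0\<close>, of "wmean (N Z)"] sol1 unfolding N_def by blast
qed

end

section \<open>Classical eigenfunctions\<close>

lemma smooth_periodic_derivative:
  assumes "smooth_periodic M f"
  shows "(f has_real_derivative deriv f x) (at x)" "smooth_periodic M (deriv f)"
proof -
  have diff: "\<And>n x. ((deriv ^^ n) f) differentiable (at x)" and per: "\<And>x. f (x + M) = f x"
    using assms by (auto simp: smooth_periodic_def smooth_def periodic_def)
  have der: "(f has_real_derivative deriv f x) (at x)" for x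
    using diff[of 0 x] by (simp add: DERIV_deriv_iff_real_differentiable)
  show "(f has_real_derivative deriv f x) (at x)" by (rule der)
  have "smooth (deriv f)"
    using diff[of "Suc _"] by (simp add: smooth_def funpow_swap1)
  moreover have "deriv f (x + M) = deriv f x" for x
  proof -
    have "((\<lambda>x. f (x + M)) has_real_derivative deriv f (x + M)) (at x)"
      using der[of "x + M"] by (simp add: DERIV_shift)
    then show ?thesis using per by (simp add: DERIV_imp_deriv)
  qed
  ultimately show "smooth_periodic M (deriv f)"
    by (simp add: smooth_periodic_def periodic_def)
qed

lemma smooth_periodic_const: "smooth_periodic M (\<lambda>x. c)"
proof -
  have "(deriv ^^ n) (\<lambda>x. c) = (\<lambda>x. if n = 0 then c else 0)" for n
    by (induction n) auto
  then show ?thesis by (auto simp: smooth_periodic_def smooth_def periodic_def)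
qed

lemma smooth_periodic_continuous: "smooth_periodic M f \<Longrightarrow> continuous_on UNIV f"
  using smooth_periodic_derivative(1) DERIV_continuous_on has_field_derivative_at_within by metis

lemma continuous_set_integral:
  fixes f :: "real \<Rightarrow> 'a::euclidean_space"
  assumes "continuous_on UNIV f"
  shows "set_integrable lborel {0..M} f" "(LINT x:{0..M}|lborel. f x) = integral {0..M} f"
proof -
  show *: "set_integrable lborel {0..M} f"
    unfolding set_integrable_def
    by (intro borel_integrable_compact continuous_on_subset[OF assms]) auto
  show "(LINT x:{0..M}|lborel. f x) = integral {0..M} f"
    by (rule set_borel_integral_eq_integral(2)[OF *])
qed

lemma continuous_periodic_L2_per:
  assumes "continuous_on UNIV u" "periodic M u"
  shows "L2_per M u"
proof -
  have "continuous_on UNIV (\<lambda>x. (cmod (u x))\<^sup>2)" by (intro continuous_intros assms)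
  then show ?thesis
    using assms by (simp add: L2_per_def continuous_set_integral borel_measurable_continuous_onI)
qed

text \<open>Integration by parts: the derivative of the periodic product of \<open>u\<close> with a
  test function integrates to zero, leaving no boundary term.\<close>

lemma classical_weak_deriv_per:
  assumes M: "M > 0" and u: "periodic M u" "\<And>x. (u has_vector_derivative v x) (at x)"
    and v: "continuous_on UNIV v"
  shows "weak_deriv_per M u v"
  unfolding weak_deriv_per_def
proof (intro allI impI)
  fix \<phi> assume \<phi>: "smooth_periodic M \<phi>"
  note \<phi>' = smooth_periodic_derivative[OF \<phi>]
  have cont: "continuous_on UNIV u" using u(2) by (rule continuous_on_vector_derivative)
  have cont1: "continuous_on UNIV (\<lambda>x. u x * complex_of_real (deriv \<phi> x))"
    and cont2: "continuous_on UNIV (\<lambda>x. v x * complex_of_real (\<phi> x))"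
    using cont v smooth_periodic_continuous \<phi> \<phi>'(2) by (auto intro!: continuous_on_mult continuous_on_of_real)
  have "((\<lambda>x. complex_of_real (\<phi> x)) has_vector_derivative of_real (deriv \<phi> x)) (at x)" for x
    using \<phi>'(1) by (rule has_vector_derivative_of_real)
  then have "((\<lambda>x. u x * complex_of_real (\<phi> x)) has_vector_derivative
      u x * complex_of_real (deriv \<phi> x) + v x * complex_of_real (\<phi> x)) (at x)" for x
    by (intro has_vector_derivative_mult u)
  moreover have "periodic M (\<lambda>x. u x * complex_of_real (\<phi> x))"
    using u \<phi> by (simp add: periodic_def smooth_periodic_def)
  ultimately have "((\<lambda>x. u x * complex_of_real (deriv \<phi> x) + v x * complex_of_real (\<phi> x)) has_integral 0) {0..M}"
    by (rule integral_derivative_periodic[OF _ M])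
  then have "integral {0..M} (\<lambda>x. u x * complex_of_real (deriv \<phi> x) + v x * complex_of_real (\<phi> x)) = 0"
    by (rule integral_unique)
  then have "integral {0..M} (\<lambda>x. u x * complex_of_real (deriv \<phi> x)) + integral {0..M} (\<lambda>x. v x * complex_of_real (\<phi> x)) = 0"
    by (subst (asm) Henstock_Kurzweil_Integration.integral_add)
      (auto intro!: integrable_continuous_real continuous_on_subset[OF cont1] continuous_on_subset[OF cont2])
  then show "(LINT x:{0..M}|lborel. u x * complex_of_real (deriv \<phi> x)) = - (LINT x:{0..M}|lborel. v x * complex_of_real (\<phi> x))"
    by (simp add: continuous_set_integral cont1 cont2 eq_neg_iff_add_eq_0)
qed

lemma classical_eigenvalue:
  assumes M: "M > 0" and per: "periodic M u" "periodic M v1" "periodic M v2" "periodic M v3"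
    and der: "\<And>x. (u has_vector_derivative v1 x) (at x)" "\<And>x. (v1 has_vector_derivative v2 x) (at x)"
      "\<And>x. (v2 has_vector_derivative v3 x) (at x)"
    and cont: "continuous_on UNIV v3" and nz: "\<And>x. u x \<noteq> 0"
    and eq: "\<And>x. complex_of_real (a x) * v3 x + complex_of_real (b x) * v2 x
           + complex_of_real (c x) * v1 x + complex_of_real (d x) * u x = lam * u x"
  shows "eigenvalue_L M a b c d lam"
proof -
  have c: "continuous_on UNIV u" "continuous_on UNIV v1" "continuous_on UNIV v2"
    by (rule continuous_on_vector_derivative, rule der)+
  have "H3_with M u v1 v2 v3"
    unfolding H3_with_def
    by (intro conjI continuous_periodic_L2_per classical_weak_deriv_per M per der cont c)
  moreover have "\<not> (AE x in lborel. x \<in> {0..M} \<longrightarrow> u x = 0)"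
  proof
    assume "AE x in lborel. x \<in> {0..M} \<longrightarrow> u x = 0"
    then have "AE x in lborel. x \<notin> {0..M}" using nz by simp
    then have "{0..M} \<in> null_sets lborel" by (subst AE_iff_null_sets) auto
    then show False using M by (auto simp: null_sets_def)
  qed
  ultimately show ?thesis
    unfolding eigenvalue_L_def by (intro exI conjI) (assumption, assumption, simp add: eq)
qed


section \<open>The Riccati substitution\<close>

text \<open>The functions obtained from smooth ones and \<open>\<alpha> = a\<^bsup>-1/3\<^esup>\<close> by sums and products are
  closed under differentiation, because \<open>\<alpha>' = - \<alpha>\<^sup>4 a' / 3\<close>.\<close>
inductive generated :: "real \<Rightarrow> (real \<Rightarrow> real) \<Rightarrow> (real \<Rightarrow> real) \<Rightarrow> bool" for M \<alpha> where
  base: "smooth_periodic M f \<Longrightarrow> generated M \<alpha> f"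
| gen: "generated M \<alpha> \<alpha>"
| add: "generated M \<alpha> f \<Longrightarrow> generated M \<alpha> g \<Longrightarrow> generated M \<alpha> (\<lambda>x. f x + g x)"
| mult: "generated M \<alpha> f \<Longrightarrow> generated M \<alpha> g \<Longrightarrow> generated M \<alpha> (\<lambda>x. f x * g x)"

lemma generated_const: "generated M \<alpha> (\<lambda>x. c)"
  by (intro generated.base smooth_periodic_const)

lemma generated_diff:
  assumes "generated M \<alpha> f" "generated M \<alpha> g"
  shows "generated M \<alpha> (\<lambda>x. f x - g x)"
proof -
  have "generated M \<alpha> (\<lambda>x. f x + (- 1) * g x)"
    by (intro generated.add generated.mult generated_const assms)
  then show ?thesis by simp
qed

lemma generated_power: "generated M \<alpha> f \<Longrightarrow> generated M \<alpha> (\<lambda>x. f x ^ n)"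
  by (induction n) (auto intro: generated_const generated.mult)

lemmas generated_intros = generated.intros(2-) generated_const generated_diff generated_power

text \<open>Here \<open>al1\<close>, \<open>al2\<close> stand for the derivatives of \<alpha>,
  \<open>P1\<close>, \<open>P2\<close> for \<partial>P, \<partial>\<partial>P, and \<open>t\<close>
  for i k. If u' = \<alpha> P u, the three parenthesised factors are u'''/u, u''/u and u'/u, so the
  left side is L u / u.\<close>

lemma riccati_algebra:
  fixes a :: complex
  assumes a: "a * al^3 = 1" and P: "P = t + \<beta> + Q" and P1: "P1 = \<beta>1 + w"
    and P2: "P2 = \<beta>2 - 3 * t * w - 3 * t^2 * Q + \<mu> - N"
    and B: "B = 3 * a * al * al1 + b * al^2" and C: "C = a * al2 + b * al1 + c * al"
    and \<beta>: "B = s - 3 * \<beta>"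
    and N: "N = A0 + A1 * Q + s * w + 3 * Q * w + (3 * t + s) * Q^2 + Q^3"
    and A0: "A0 = (\<beta>2 + 3 * \<beta> * \<beta>1 + \<beta>^3 + B * \<beta>1 + B * \<beta>^2 + C * \<beta> + d) + t * (3 * \<beta>1 + 3 * \<beta>^2 + 2 * B * \<beta> + C)"
    and A1: "A1 = (3 * \<beta>1 + 3 * \<beta>^2 + 2 * B * \<beta> + C) + t * (6 * \<beta> + 2 * B)"
  shows "a * (al2 * P + 3 * al * al1 * (P1 + P^2) + al^3 * (P2 + 3 * P * P1 + P^3))
      + b * (al1 * P + al^2 * (P1 + P^2)) + c * (al * P) + d = t^3 + s * t^2 + \<mu>"
proof -
  have "a * (al2 * P + 3 * al * al1 * (P1 + P^2) + al^3 * (P2 + 3 * P * P1 + P^3))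
      + b * (al1 * P + al^2 * (P1 + P^2)) + c * (al * P) + d
      = (a * al^3) * (P2 + 3 * P * P1 + P^3) + B * (P1 + P^2) + C * P + d"
    unfolding B C by (simp add: algebra_simps)
  \<comment> \<open>At order \<open>t^2\<close>, \<open>B = s - 3 * \<beta>\<close> leaves
    \<open>s + 3 * Q\<close>, and the term with \<open>Q\<close> cancels against \<open>P2\<close>.
    \<open>A0\<close> and \<open>A1\<close> collect what remains of degree 0 and 1 in
    \<open>Q\<close> alone.\<close>
  also have "\<dots> = t^3 + s * t^2 + \<mu>"
    unfolding a P P1 P2 N A0 A1 \<beta> by (simp add: algebra_simps power2_eq_square power3_eq_cube)
  finally show ?thesis .
qed

section \<open>The operator in the variable of the weight \<alpha>\<close>

locale third_order_operator =
  fixes M :: real and a b c d :: "real \<Rightarrow> real"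
  assumes M_positive: "M > 0"
    and coeffs: "smooth_periodic M a" "smooth_periodic M b" "smooth_periodic M c" "smooth_periodic M d"
    and a_pos: "\<And>x. a x > 0"
begin

definition \<alpha> :: "real \<Rightarrow> real" where "\<alpha> x = a x powr (- 1 / 3)"

lemma \<alpha>_positive: "\<alpha> x > 0"
  using a_pos[of x] by (simp add: \<alpha>_def)

lemma a_\<alpha>_cube: "a x * \<alpha> x ^ 3 = 1"
proof -
  have "\<alpha> x ^ 3 = a x powr (- 1)"
    using a_pos[of x] by (simp add: \<alpha>_def powr_power)
  then show ?thesis using a_pos[of x] by (simp add: powr_minus)
qed

lemma \<alpha>_has_derivative: "(\<alpha> has_real_derivative (- 1 / 3) * \<alpha> x ^ 4 * deriv a x) (at x)"
proof -
  have "((\<lambda>z. z powr (- 1 / 3)) has_real_derivative (- 1 / 3) * a x powr (- 1 / 3 - 1)) (at (a x))"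
    using a_pos by (rule has_real_derivative_powr)
  from DERIV_chain2[OF this smooth_periodic_derivative(1)[OF coeffs(1)]]
  have "(\<alpha> has_real_derivative (- 1 / 3) * a x powr (- 1 / 3 - 1) * deriv a x) (at x)"
    by (simp add: \<alpha>_def[abs_def])
  moreover have "a x powr (- 1 / 3 - 1) = \<alpha> x ^ 4"
    using a_pos[of x] by (simp add: \<alpha>_def powr_power)
  ultimately show ?thesis by simp
qed

abbreviation gen :: "(real \<Rightarrow> real) \<Rightarrow> bool" where "gen \<equiv> generated M \<alpha>"

lemma gen_derivative:
  assumes "gen f"
  shows "\<exists>g. gen g \<and> (\<forall>x. (f has_real_derivative g x) (at x))"
  using assms
proof induction
  case (base f)
  then show ?case using smooth_periodic_derivative generated.base by blast
next
  case gen
  have "gen (\<lambda>x. (- 1 / 3) * \<alpha> x ^ 4 * deriv a x)"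
    using coeffs smooth_periodic_derivative(2) by (intro generated_intros generated.base) auto
  then show ?case using \<alpha>_has_derivative by blast
next
  case (add f g)
  then obtain f' g' where "gen f'" "gen g'" "\<And>x. (f has_real_derivative f' x) (at x)"
    "\<And>x. (g has_real_derivative g' x) (at x)" by blast
  then show ?case by (blast intro: DERIV_add generated.add)
next
  case (mult f g)
  then obtain f' g' where "gen f'" "gen g'" "\<And>x. (f has_real_derivative f' x) (at x)"
    "\<And>x. (g has_real_derivative g' x) (at x)" by blast
  moreover have "gen (\<lambda>x. f' x * g x + g' x * f x)"
    using mult.hyps \<open>gen f'\<close> \<open>gen g'\<close> by (intro generated_intros)
  ultimately show ?case by (blast intro: DERIV_mult)
qed

lemma gen_deriv:
  assumes "gen f"
  shows "gen (deriv f)" "(f has_real_derivative deriv f x) (at x)"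
proof -
  obtain g where g: "gen g" "\<And>x. (f has_real_derivative g x) (at x)"
    using gen_derivative[OF assms] by blast
  then have "deriv f = g" by (auto intro: DERIV_imp_deriv)
  then show "gen (deriv f)" "(f has_real_derivative deriv f x) (at x)" using g by auto
qed

lemma gen_continuous: "gen f \<Longrightarrow> continuous_on UNIV f"
  using gen_deriv(2) DERIV_continuous_on has_field_derivative_at_within by metis

lemma gen_periodic: "gen f \<Longrightarrow> periodic M f"
  by (induction rule: generated.induct)
    (use coeffs in \<open>auto simp: periodic_def smooth_periodic_def \<alpha>_def\<close>)

sublocale weighted_circle M \<alpha>
  by standard (auto intro: M_positive \<alpha>_positive gen_continuous gen_periodic generated.gen)

lemma gen_percont: "gen f \<Longrightarrow> percont (\<lambda>x. complex_of_real (f x))"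
  using gen_continuous[of f] gen_periodic[of f]
  by (simp add: percont_def periodic_def continuous_on_of_real)

lemma gen_bounded:
  assumes "gen f"
  obtains K where "K \<ge> 0" "\<And>x. \<bar>f x\<bar> \<le> K"
proof -
  obtain K where K: "\<And>x. norm (f x) \<le> K"
    using periodic_continuous_bounded[OF M_positive gen_periodic[OF assms] gen_continuous[OF assms]] by blast
  moreover have "K \<ge> 0" using order_trans[OF norm_ge_zero K] .
  ultimately show ?thesis using that by auto
qed

text \<open>Both \<open>A0\<close> and \<open>A1\<close> have this shape; one \<open>K\<close>
  serves all \<open>k \<ge> 1\<close>, so that the threshold for the contraction can be fixed in
  advance.\<close>

lemma gen_affine_bounded:
  assumes "gen f" "gen g"
  obtains K where "K \<ge> 0" "\<And>k x. k \<ge> 1 \<Longrightarrow> norm (of_real (f x) + \<i> * of_real k * of_real (g x)) \<le> K * k"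
proof -
  obtain K where K: "K \<ge> 0" "\<And>x. \<bar>f x\<bar> \<le> K" by (rule gen_bounded[OF assms(1)]) blast
  obtain L where L: "L \<ge> 0" "\<And>x. \<bar>g x\<bar> \<le> L" by (rule gen_bounded[OF assms(2)]) blast
  have "norm (of_real (f x) + \<i> * of_real k * of_real (g x)) \<le> (K + L) * k" if "k \<ge> 1" for k x
  proof -
    have "norm (of_real (f x) + \<i> * of_real k * of_real (g x)) \<le> \<bar>f x\<bar> + k * \<bar>g x\<bar>"
      using norm_triangle_ineq[of "of_real (f x)" "\<i> * of_real k * of_real (g x)"] that
      by (simp add: norm_mult)
    also have "\<dots> \<le> K * k + k * L"
      using K L that mult_left_mono[OF that K(1)] order_trans[OF K(2)] by (intro add_mono mult_left_mono) auto
    finally show ?thesis by (simp add: algebra_simps)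
  qed
  then show ?thesis using that K L by (meson add_nonneg_nonneg)
qed

text \<open>This is \<open>\<partial>f = f' / \<alpha>\<close>, since \<open>a \<alpha>\<^sup>3 = 1\<close>; the form avoids division.\<close>
definition D :: "(real \<Rightarrow> real) \<Rightarrow> real \<Rightarrow> real" where
  "D f x = a x * \<alpha> x ^ 2 * deriv f x"

text \<open>\<open>B\<close> and \<open>C\<close> are the coefficients of \<partial>\<partial> and
  \<partial> in L; the derivatives of \<alpha> enter on replacing d/dx by \<alpha>
  \<partial>.\<close>

definition B :: "real \<Rightarrow> real" where
  "B x = 3 * a x * \<alpha> x * deriv \<alpha> x + b x * \<alpha> x ^ 2"

definition C :: "real \<Rightarrow> real" where
  "C x = a x * deriv (deriv \<alpha>) x + b x * deriv \<alpha> x + c x * \<alpha> x"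

definition s :: real where
  "s = integral {0..M} (\<lambda>x. b x / a x) / integral {0..M} \<alpha>"

definition \<beta> :: "real \<Rightarrow> real" where "\<beta> x = (1 / 3) * (s - B x)"

lemma gen_coeffs: "gen a" "gen b" "gen c" "gen d"
  using coeffs by (auto intro: generated.base)

lemma gen_D: "gen f \<Longrightarrow> gen (D f)"
  unfolding D_def[abs_def] by (intro generated_intros gen_deriv gen_coeffs)

lemma gen_B: "gen B"
  unfolding B_def[abs_def] by (intro generated_intros gen_deriv gen_coeffs)

lemma gen_C: "gen C"
  unfolding C_def[abs_def] by (intro generated_intros gen_deriv gen_coeffs)

lemma gen_\<beta>: "gen \<beta>"
  unfolding \<beta>_def[abs_def] by (intro generated_intros gen_B)

lemma gen_has_derivative_D:
  assumes "gen f"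
  shows "((\<lambda>x. complex_of_real (f x)) has_vector_derivative of_real (\<alpha> x) * of_real (D f x)) (at x)"
proof -
  have "deriv f x = \<alpha> x * D f x"
    using a_\<alpha>_cube[of x] by (simp add: D_def power2_eq_square power3_eq_cube mult_ac)
  then show ?thesis
    using has_vector_derivative_of_real[OF gen_deriv(2)[OF assms], of x] by simp
qed

text \<open>Here \<open>\<alpha> B = 3 \<alpha>' / \<alpha> + b / a\<close>, and \<open>\<alpha>' / \<alpha>\<close> is the derivative of the periodic function \<open>ln \<alpha>\<close>.\<close>
lemma wmean_\<beta>: "wmean (\<lambda>x. of_real (\<beta> x)) = 0"
proof -
  have "((\<lambda>x. ln (\<alpha> x)) has_vector_derivative deriv \<alpha> x / \<alpha> x) (at x)" for x
    using DERIV_ln_divide[OF \<alpha>_positive] gen_deriv(2)[OF generated.gen]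
    by (auto simp: has_real_derivative_iff_has_vector_derivative[symmetric] intro!: derivative_eq_intros \<alpha>_positive simp: field_simps)
  then have ln: "((\<lambda>x. deriv \<alpha> x / \<alpha> x) has_integral 0) {0..M}"
    using \<alpha>_per by (intro integral_derivative_periodic[OF _ M_pos, of "\<lambda>x. ln (\<alpha> x)"]) (auto simp: periodic_def)
  have ba: "((\<lambda>x. b x / a x) has_integral s * integral {0..M} \<alpha>) {0..M}"
  proof -
    have "continuous_on {0..M} (\<lambda>x. b x / a x)"
      using a_pos by (intro continuous_on_divide continuous_on_subset[OF gen_continuous[OF gen_coeffs(1)]]
          continuous_on_subset[OF gen_continuous[OF gen_coeffs(2)]]) (auto simp: less_imp_neq[symmetric])
    then show ?thesis
      using integrable_integral[OF integrable_continuous_real, of 0 M "\<lambda>x. b x / a x"] integral_\<alpha>_pos by (simp add: s_def)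
  qed
  have "((\<lambda>x. (1 / 3) * (s * \<alpha> x - (3 * (deriv \<alpha> x / \<alpha> x) + b x / a x))) has_integral
      (1 / 3) * (s * integral {0..M} \<alpha> - (3 * 0 + s * integral {0..M} \<alpha>))) {0..M}"
    by (intro has_integral_mult_right has_integral_diff has_integral_add ln ba integrable_integral \<alpha>_int)
  moreover have "(1 / 3) * (s * \<alpha> x - (3 * (deriv \<alpha> x / \<alpha> x) + b x / a x)) = \<alpha> x * \<beta> x" for x
  proof -
    have "1 / \<alpha> x = a x * \<alpha> x ^ 2" "1 / a x = \<alpha> x ^ 3"
      using a_\<alpha>_cube[of x] \<alpha>_positive[of x] a_pos[of x] by (simp_all add: field_simps power2_eq_square power3_eq_cube)
    then have "3 * (deriv \<alpha> x * (1 / \<alpha> x)) + b x * (1 / a x) = \<alpha> x * B x"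
      by (simp only: B_def) (simp add: algebra_simps power2_eq_square power3_eq_cube)
    then show ?thesis by (simp add: \<beta>_def algebra_simps)
  qed
  ultimately have "((\<lambda>x. \<alpha> x * \<beta> x) has_integral 0) {0..M}" by simp
  then have "((\<lambda>x. complex_of_real (\<alpha> x * \<beta> x)) has_integral of_real 0) {0..M}"
    by (rule has_integral_of_real)
  then show ?thesis by (simp add: wmean_def integral_unique)
qed

text \<open>The coefficients of the Riccati equation for \<open>Q\<close> are \<open>A0 = E0 + i k E1\<close> and \<open>A1 = E1 + i k E2\<close>.\<close>
definition E0 :: "real \<Rightarrow> real" where
  "E0 x = D (D \<beta>) x + 3 * \<beta> x * D \<beta> x + \<beta> x ^ 3 + B x * D \<beta> x + B x * \<beta> x ^ 2 + C x * \<beta> x + d x"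

definition E1 :: "real \<Rightarrow> real" where
  "E1 x = 3 * D \<beta> x + 3 * \<beta> x ^ 2 + 2 * B x * \<beta> x + C x"

definition E2 :: "real \<Rightarrow> real" where
  "E2 x = 6 * \<beta> x + 2 * B x"

lemma gen_E: "gen E0" "gen E1" "gen E2"
  unfolding E0_def[abs_def] E1_def[abs_def] E2_def[abs_def]
  by (intro generated_intros gen_\<beta> gen_B gen_C gen_D gen_coeffs)+

text \<open>The eigenfunction is \<open>exp (F x)\<close> with F' = \<alpha> P. As \<beta> and
  \<open>Q\<close> have mean zero, only i k contributes to the increment of \<open>F\<close> over a
  period, and the condition on \<open>k\<close> makes that increment a multiple of 2 pi i.\<close>

lemma eigenfunction_from_riccati:
  fixes k :: real and n :: nat and \<mu> :: complex and Q Z :: "real \<Rightarrow> complex"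
  defines "A0 \<equiv> \<lambda>x. of_real (E0 x) + \<i> * of_real k * of_real (E1 x)"
    and "A1 \<equiv> \<lambda>x. of_real (E1 x) + \<i> * of_real k * of_real (E2 x)"
  assumes k: "k * integral {0..M} \<alpha> = 2 * pi * of_nat n"
    and Q: "resolvent_sol M \<alpha> (root2 * of_real k) Z Q"
    and Z: "resolvent_sol M \<alpha> (root1 * of_real k)
       (\<lambda>x. \<mu> - nonlin s k (A0 x) (A1 x) (Q x) (Z x + root2 * of_real k * Q x)) Z"
    and Q0: "wmean Q = 0"
  shows "eigenvalue_L M a b c d ((\<i> * of_real k)^3 + of_real s * (\<i> * of_real k)^2 + \<mu>)"
proof -
  let ?t = "\<i> * complex_of_real k" and ?\<alpha> = "\<lambda>x. complex_of_real (\<alpha> x)"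
  \<comment> \<open>\<open>w\<close> is \<partial>Q; \<open>P1\<close> and \<open>P2\<close> are
    written as \<partial>P and \<partial>\<partial>P should come out, which \<open>dP\<close> and
    \<open>dP1\<close> confirm.\<close>
  define w where "w x = Z x + root2 * of_real k * Q x" for x
  define N where "N x = nonlin s k (A0 x) (A1 x) (Q x) (w x)" for x
  define P where "P x = ?t + of_real (\<beta> x) + Q x" for x
  define P1 where "P1 x = of_real (D \<beta> x) + w x" for x
  define P2 where "P2 x = of_real (D (D \<beta>) x) - 3 * ?t * w x - 3 * ?t^2 * Q x + \<mu> - N x" for x
  have pcA: "percont A0" "percont A1"
    unfolding A0_def A1_def by (intro percont_ops gen_percont gen_E)+
  have pcQ: "percont Q" "percont Z" using Q Z resolvent_sol_percont by blast+
  have pcw: "percont w" unfolding w_def[abs_def] by (intro percont_ops pcQ)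
  have pcN: "percont N" unfolding N_def[abs_def] nonlin_def by (intro percont_ops pcA pcQ pcw)
  have pcP: "percont P" "percont P1" "percont P2"
    unfolding P_def[abs_def] P1_def[abs_def] P2_def[abs_def]
    by (intro percont_ops gen_percont gen_\<beta> gen_D pcQ pcw pcN)+
  have dQ: "(Q has_vector_derivative ?\<alpha> x * w x) (at x)" for x
    using Q by (simp add: resolvent_sol_def w_def add.commute)
  have dZ: "(Z has_vector_derivative ?\<alpha> x * (root1 * of_real k * Z x + \<mu> - N x)) (at x)" for x
    using Z by (simp add: resolvent_sol_def w_def N_def add_diff_eq)
  have dw: "(w has_vector_derivative
      ?\<alpha> x * (root1 * of_real k * Z x + \<mu> - N x) + root2 * of_real k * (?\<alpha> x * w x)) (at x)" for x
  proof -
    have "w = (\<lambda>x. Z x + root2 * of_real k * Q x)" by (simp add: w_def fun_eq_iff)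
    then show ?thesis
      using has_vector_derivative_add[OF dZ has_vector_derivative_mult_right[OF dQ]] by simp
  qed
  have dP: "(P has_vector_derivative ?\<alpha> x * P1 x) (at x)" for x
  proof -
    have "(P has_vector_derivative 0 + ?\<alpha> x * of_real (D \<beta> x) + ?\<alpha> x * w x) (at x)"
      unfolding P_def[abs_def]
      by (intro has_vector_derivative_add has_vector_derivative_const gen_has_derivative_D gen_\<beta> dQ)
    then show ?thesis by (simp add: P1_def algebra_simps)
  qed
  have dP1: "(P1 has_vector_derivative ?\<alpha> x * P2 x) (at x)" for x
  proof -
    have d: "(P1 has_vector_derivative ?\<alpha> x * of_real (D (D \<beta>) x)
        + (?\<alpha> x * (root1 * of_real k * Z x + \<mu> - N x) + root2 * of_real k * (?\<alpha> x * w x))) (at x)"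
      unfolding P1_def[abs_def]
      by (intro has_vector_derivative_add gen_has_derivative_D gen_D gen_\<beta> dw)
    \<comment> \<open>Vieta's formulas recover the unfactored linear part.\<close>
    have roots: "root1 * of_real k * Z x + root2 * of_real k * w x = - 3 * ?t * w x - 3 * ?t^2 * Q x"
    proof -
      have "root1 * of_real k * Z x + root2 * of_real k * w x
          = (root1 + root2) * of_real k * w x - (root1 * root2) * (of_real k)^2 * Q x"
        by (simp add: w_def algebra_simps power2_eq_square)
      then show ?thesis by (simp add: root_sum root_prod power_mult_distrib)
    qed
    have "?\<alpha> x * of_real (D (D \<beta>) x)
        + (?\<alpha> x * (root1 * of_real k * Z x + \<mu> - N x) + root2 * of_real k * (?\<alpha> x * w x))
        = ?\<alpha> x * (of_real (D (D \<beta>) x) + (root1 * of_real k * Z x + root2 * of_real k * w x) + \<mu> - N x)"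
      by (simp add: algebra_simps)
    also have "\<dots> = ?\<alpha> x * P2 x"
      unfolding roots P2_def by simp
    finally show ?thesis
      using d by simp
  qed
  have "continuous_on UNIV (\<lambda>x. ?\<alpha> x * P x)"
    using pcP(1) \<alpha>_cont by (simp add: percont_def continuous_on_mult continuous_on_of_real)
  then obtain F where F: "\<And>x. (F has_vector_derivative ?\<alpha> x * P x) (at x)"
    by (rule continuous_antiderivative) blast
  have "wmean (\<lambda>x. (P x - Q x) - of_real (\<beta> x)) = (wmean P - wmean Q) - wmean (\<lambda>x. of_real (\<beta> x))"
    by (simp add: wmean_diff percont_ops pcP pcQ gen_percont gen_\<beta>)
  moreover have "(\<lambda>x. (P x - Q x) - of_real (\<beta> x)) = (\<lambda>x. ?t)"
    by (simp add: P_def)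
  ultimately have "wmean P = ?t"
    using Q0 wmean_\<beta> wmean_const[of ?t] by simp
  then have "integral {0..M} (\<lambda>x. ?\<alpha> x * P x) = ?t * of_real (integral {0..M} \<alpha>)"
    using integral_\<alpha>_pos by (simp add: wmean_def field_simps)
  also have "\<dots> = \<i> * of_real (k * integral {0..M} \<alpha>)" by simp
  finally have F_period: "F M - F 0 = 2 * of_real pi * of_nat n * \<i>"
    using integral_unique[OF integral_derivative[OF F M_pos]] unfolding k by (simp add: mult_ac)
  define u where "u x = exp (F x)" for x
  have du: "(u has_vector_derivative ?\<alpha> x * P x * u x) (at x)" for x
    using field_vector_diff_chain_at[OF F[of x] DERIV_exp] by (simp add: u_def[abs_def] o_def)
  have u_per: "periodic M u"
  proof -
    \<comment> \<open>\<open>F\<close> itself need not be periodic; removing its linear drift gives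
      a periodic \<open>G\<close>, whence \<open>F\<close> grows by the same amount over every
      period.\<close>
    define q where "q = (F M - F 0) / of_real M"
    define G where "G x = F x - x *\<^sub>R q" for x
    have "((\<lambda>x. x *\<^sub>R q) has_vector_derivative q) (at x)" for x
      by (auto intro!: derivative_eq_intros simp: has_vector_derivative_def)
    then have "(G has_vector_derivative ?\<alpha> x * P x - q) (at x)" for x
      unfolding G_def[abs_def] by (intro has_vector_derivative_diff F)
    moreover have "periodic M (\<lambda>x. ?\<alpha> x * P x - q)"
      using pcP(1) \<alpha>_per by (simp add: periodic_def percont_def)
    moreover have Mq: "M *\<^sub>R q = F M - F 0"
      using M_pos by (simp add: q_def scaleR_conv_of_real)
    then have "G M = G 0" by (simp add: G_def)
    ultimately have "periodic M G" by (rule antiderivative_periodic)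
    then have G: "G (x + M) = G x" for x by (simp add: periodic_def)
    have "F (x + M) = F x + (F M - F 0)" for x
      using G[of x] Mq by (simp add: G_def scaleR_add_left algebra_simps)
    then have "exp (F (x + M)) = exp (F x)" for x
      using exp_integer_2pi[OF Ints_of_nat[of n]] unfolding F_period exp_add
      by (simp add: mult_ac exp_add)
    then show ?thesis by (simp add: periodic_def u_def)
  qed
  have d\<alpha>: "(?\<alpha> has_vector_derivative of_real (deriv \<alpha> x)) (at x)"
    "((\<lambda>x. complex_of_real (deriv \<alpha> x)) has_vector_derivative of_real (deriv (deriv \<alpha>) x)) (at x)" for x
    by (intro has_vector_derivative_of_real gen_deriv generated.gen)+
  \<comment> \<open>These are the first three classical derivatives of \<open>u\<close>, written as
    multiples of \<open>u\<close>.\<close>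
  define v1 where "v1 x = (?\<alpha> x * P x) * u x" for x
  define v2 where "v2 x = (of_real (deriv \<alpha> x) * P x + ?\<alpha> x * ?\<alpha> x * (P1 x + P x * P x)) * u x" for x
  define v3 where "v3 x = (of_real (deriv (deriv \<alpha>) x) * P x + 3 * ?\<alpha> x * of_real (deriv \<alpha> x) * (P1 x + P x ^ 2)
      + ?\<alpha> x ^ 3 * (P2 x + 3 * P x * P1 x + P x ^ 3)) * u x" for x
  have dv1: "(v1 has_vector_derivative v2 x) (at x)" for x
    unfolding v1_def[abs_def]
    by (rule has_vector_derivative_eq_rhs, (rule has_vector_derivative_mult d\<alpha> dP du)+)
      (simp add: v2_def algebra_simps)
  have dv2: "(v2 has_vector_derivative v3 x) (at x)" for x
    unfolding v2_def[abs_def]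
    by (rule has_vector_derivative_eq_rhs, (rule has_vector_derivative_mult has_vector_derivative_add d\<alpha> dP dP1 du)+)
      (simp add: v3_def algebra_simps power2_eq_square power3_eq_cube)
  have pc: "percont u" "percont ?\<alpha>" "percont (\<lambda>x. of_real (deriv \<alpha> x))" "percont (\<lambda>x. of_real (deriv (deriv \<alpha>) x))"
    using u_per continuous_on_vector_derivative[OF du]
    by (simp add: percont_def) (intro gen_percont gen_deriv generated.gen)+
  have pcv: "percont v1" "percont v2" "percont v3"
    unfolding v1_def[abs_def] v2_def[abs_def] v3_def[abs_def] by (intro percont_ops pc pcP)+
  show ?thesis
  proof (rule classical_eigenvalue[of M u v1 v2 v3])
    fix x
    let ?c = "complex_of_real"
    have "?c (a x * \<alpha> x ^ 3) = 1" by (simp only: a_\<alpha>_cube of_real_1)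
    then have cube: "?c (a x) * ?\<alpha> x ^ 3 = 1" by simp
    have "?c (a x) * (of_real (deriv (deriv \<alpha>) x) * P x + 3 * ?\<alpha> x * of_real (deriv \<alpha> x) * (P1 x + P x ^ 2)
        + ?\<alpha> x ^ 3 * (P2 x + 3 * P x * P1 x + P x ^ 3))
        + ?c (b x) * (of_real (deriv \<alpha> x) * P x + ?\<alpha> x ^ 2 * (P1 x + P x ^ 2)) + ?c (c x) * (?\<alpha> x * P x) + ?c (d x)
        = ?t ^ 3 + ?c s * ?t ^ 2 + \<mu>"
    proof (rule riccati_algebra[OF cube P_def P1_def P2_def])
      show "?c (B x) = 3 * ?c (a x) * ?\<alpha> x * of_real (deriv \<alpha> x) + ?c (b x) * ?\<alpha> x ^ 2"
        by (simp add: B_def)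
      show "?c (C x) = ?c (a x) * of_real (deriv (deriv \<alpha>) x) + ?c (b x) * of_real (deriv \<alpha> x) + ?c (c x) * ?\<alpha> x"
        by (simp add: C_def)
      have "B x = s - 3 * \<beta> x" by (simp add: \<beta>_def diff_divide_distrib)
      then show "?c (B x) = of_real s - 3 * of_real (\<beta> x)" by simp
      show "N x = A0 x + A1 x * Q x + of_real s * w x + 3 * Q x * w x + (3 * ?t + of_real s) * (Q x)^2 + (Q x)^3"
        by (simp add: N_def nonlin_def mult.assoc)
    qed (simp_all add: A0_def A1_def E0_def E1_def E2_def)
    then have "(?c (a x) * (of_real (deriv (deriv \<alpha>) x) * P x + 3 * ?\<alpha> x * of_real (deriv \<alpha> x) * (P1 x + P x ^ 2)
        + ?\<alpha> x ^ 3 * (P2 x + 3 * P x * P1 x + P x ^ 3))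
        + ?c (b x) * (of_real (deriv \<alpha> x) * P x + ?\<alpha> x ^ 2 * (P1 x + P x ^ 2)) + ?c (c x) * (?\<alpha> x * P x) + ?c (d x)) * u x
        = (?t ^ 3 + ?c s * ?t ^ 2 + \<mu>) * u x" by simp
    then show "?c (a x) * v3 x + ?c (b x) * v2 x + ?c (c x) * v1 x + ?c (d x) * u x
        = (?t ^ 3 + ?c s * ?t ^ 2 + \<mu>) * u x"
      unfolding v1_def v2_def v3_def by (simp only: distrib_right mult.assoc power2_eq_square)
  qed (use M_pos pcv u_per du dv1 dv2 in \<open>auto simp: percont_def v1_def u_def\<close>)
qed

lemma eigenvalues_asymptotics:
  obtains K k0 where
    "\<And>n k. k * integral {0..M} \<alpha> = 2 * pi * of_nat n \<Longrightarrow> k \<ge> k0 \<Longrightarrow>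
      \<exists>lam. eigenvalue_L M a b c d lam \<and> \<bar>Re lam + s * k^2\<bar> \<le> K * k"
proof -
  obtain K0 where K0: "K0 \<ge> 0"
    "\<And>k x. k \<ge> 1 \<Longrightarrow> norm (of_real (E0 x) + \<i> * of_real k * of_real (E1 x)) \<le> K0 * k"
    by (rule gen_affine_bounded[OF gen_E(1,2)]) blast
  obtain K1 where K1: "K1 \<ge> 0"
    "\<And>k x. k \<ge> 1 \<Longrightarrow> norm (of_real (E1 x) + \<i> * of_real k * of_real (E2 x)) \<le> K1 * k"
    by (rule gen_affine_bounded[OF gen_E(2,3)]) blast
  define K where "K = K0 + K1"
  \<comment> \<open>The threshold of \<open>riccati_solution\<close>, with its radius
    \<open>8 * K\<close> inserted.\<close>
  define k0 where "k0 = max 1 (8 * (2 * K + 5 * \<bar>s\<bar> + 84 * (8 * K) + 8 * (8 * K) * \<bar>s\<bar> + 24 * (8 * K)^2))"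
  have "\<exists>lam. eigenvalue_L M a b c d lam \<and> \<bar>Re lam + s * k^2\<bar> \<le> 9 * K * k"
    if k: "k * integral {0..M} \<alpha> = 2 * pi * of_nat n" "k \<ge> k0" for n k
  proof -
    have k1: "k \<ge> 1" "k \<ge> 8 * (2 * K + 5 * \<bar>s\<bar> + 84 * (8 * K) + 8 * (8 * K) * \<bar>s\<bar> + 24 * (8 * K)^2)"
      using k(2) by (auto simp: k0_def)
    have le: "K0 * k \<le> K * k" "K1 * k \<le> K * k"
      using K0(1) K1(1) k1(1) by (auto simp: K_def)
    define A0 where "A0 x = complex_of_real (E0 x) + \<i> * of_real k * of_real (E1 x)" for x
    define A1 where "A1 x = complex_of_real (E1 x) + \<i> * of_real k * of_real (E2 x)" for x
    have pc: "percont A0" "percont A1"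
      unfolding A0_def[abs_def] A1_def[abs_def] by (intro percont_ops gen_percont gen_E)+
    have bound: "norm (A0 x) \<le> K * k" "norm (A1 x) \<le> K * k" for x
      unfolding A0_def A1_def using K0(2)[OF k1(1), of x] K1(2)[OF k1(1), of x] le by linarith+
    obtain Q Z \<mu> where sol: "resolvent_sol M \<alpha> (root2 * of_real k) Z Q"
      "resolvent_sol M \<alpha> (root1 * of_real k)
        (\<lambda>x. \<mu> - nonlin s k (A0 x) (A1 x) (Q x) (Z x + root2 * of_real k * Q x)) Z"
      "wmean Q = 0" and \<mu>: "norm \<mu> \<le> 9 * K * k"
      by (rule riccati_solution[OF k1 pc bound])
    have "\<i> ^ 3 = - \<i>" by (simp add: power3_eq_cube)
    then have "(\<i> * complex_of_real k)^3 + of_real s * (\<i> * of_real k)^2 + \<mu> = - \<i> * of_real (k^3) - of_real (s * k^2) + \<mu>"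
      by (simp add: power_mult_distrib)
    \<comment> \<open>The cubic term is purely imaginary, so the quadratic one leads.\<close>
    then have "Re ((\<i> * of_real k)^3 + of_real s * (\<i> * of_real k)^2 + \<mu>) = - (s * k^2) + Re \<mu>"
      by (simp only: plus_complex.sel minus_complex.sel) simp
    then have "\<bar>Re ((\<i> * of_real k)^3 + of_real s * (\<i> * of_real k)^2 + \<mu>) + s * k^2\<bar> \<le> 9 * K * k"
      using abs_Re_le_cmod[of \<mu>] \<mu> by simp
    with eigenfunction_from_riccati[OF k(1) sol[unfolded A0_def A1_def]] show ?thesis by blast
  qed
  then show ?thesis using that by blast
qed

end

section \<open>Divergence of the real parts along the admissible k\<close>

theorem theorem5:
  fixes M :: real and a b c d :: "real \<Rightarrow> real"
  assumes "M > 0"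
    and "smooth_periodic M a" "smooth_periodic M b" "smooth_periodic M c" "smooth_periodic M d"
    and "(INF x\<in>{0..M}. a x) > 0"
    and "(LINT y:{0..M}|lborel. b y / a y) / M \<noteq> 0"
  shows "\<exists>lam :: nat \<Rightarrow> complex. (\<forall>j. eigenvalue_L M a b c d (lam j)) \<and>
     filterlim (\<lambda>j. - ((LINT y:{0..M}|lborel. b y / a y) / M) * Re (lam j)) at_top sequentially"
proof -
  have a_cont: "continuous_on UNIV a" and b_cont: "continuous_on UNIV b"
    using assms smooth_periodic_continuous by auto
  have a_pos: "a x > 0" for x
  proof -
    obtain y where y: "y \<in> {0..M}" "a x = a y"
      using periodic_shift_into_interval[OF assms(1), of x] assms(2) by (metis smooth_periodic_def)
    have "bdd_below (a ` {0..M})"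
      by (intro bounded_imp_bdd_below compact_imp_bounded compact_continuous_image
          continuous_on_subset[OF a_cont]) auto
    then have "(INF x\<in>{0..M}. a x) \<le> a y" using y(1) by (rule cINF_lower)
    then show ?thesis using assms(6) y(2) by simp
  qed
  interpret third_order_operator M a b c d
    using assms a_pos by unfold_locales
  define \<delta> where "\<delta> = (LINT y:{0..M}|lborel. b y / a y) / M"
  define A where "A = integral {0..M} \<alpha>"
  have A: "A > 0" unfolding A_def by (rule integral_\<alpha>_pos)
  have "continuous_on UNIV (\<lambda>x. b x / a x)"
    using a_pos by (intro continuous_on_divide a_cont b_cont) (auto simp: less_imp_neq[symmetric])
  then have s: "s = \<delta> * M / A"
    using assms(1) by (simp add: s_def \<delta>_def A_def continuous_set_integral)
  obtain K k0 where K: "\<And>n k. k * A = 2 * pi * of_nat n \<Longrightarrow> k \<ge> k0 \<Longrightarrow>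
      \<exists>lam. eigenvalue_L M a b c d lam \<and> \<bar>Re lam + s * k^2\<bar> \<le> K * k"
    unfolding A_def by (rule eigenvalues_asymptotics) blast
  obtain m where m: "k0 * A / (2 * pi) \<le> real m" using real_arch_simple by blast
  \<comment> \<open>Solves the period condition for n = m + j; the shift by \<open>m\<close> keeps
    every \<open>k j\<close> above \<open>k0\<close>.\<close>
  define k where "k j = 2 * pi * real (m + j) / A" for j
  have k_ge: "k j \<ge> k0" for j
  proof -
    have "k0 * A / (2 * pi) \<le> real (m + j)" using m by simp
    then show ?thesis using A by (simp add: k_def field_simps)
  qed
  have "\<exists>lam. eigenvalue_L M a b c d lam \<and> \<bar>Re lam + s * (k j)^2\<bar> \<le> K * k j" for j
    using A by (intro K[of _ "m + j"] k_ge) (simp add: k_def)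
  then obtain lam where lam: "\<And>j. eigenvalue_L M a b c d (lam j)"
    "\<And>j. \<bar>Re (lam j) + s * (k j)^2\<bar> \<le> K * k j" by metis
  have "filterlim (\<lambda>j. 2 * pi / A * (real m + real j)) at_top sequentially"
    using A by (intro filterlim_tendsto_pos_mult_at_top[OF tendsto_const]
        filterlim_tendsto_add_at_top[OF tendsto_const] filterlim_real_sequentially) simp
  then have k_lim: "filterlim k at_top sequentially"
    by (simp add: k_def[abs_def])
  have "\<delta>^2 * M / A > 0" using assms(1,7) A by (simp add: \<delta>_def)
  \<comment> \<open>The minorant comes from multiplying the asymptotics by \<delta>: as
    \<open>s = \<delta> * M / A\<close>, the leading coefficient \<delta> s is positive whatever the
    sign of \<delta>.\<close>
  then have lower: "filterlim (\<lambda>j. k j * (- \<bar>\<delta>\<bar> * K + \<delta>^2 * M / A * k j)) at_top sequentially"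
    by (intro filterlim_at_top_mult_at_top k_lim filterlim_tendsto_add_at_top[OF tendsto_const]
        filterlim_tendsto_pos_mult_at_top[OF tendsto_const])
  have "k j * (- \<bar>\<delta>\<bar> * K + \<delta>^2 * M / A * k j) \<le> - \<delta> * Re (lam j)" for j
  proof -
    have "\<delta> * (Re (lam j) + s * (k j)^2) \<le> \<bar>\<delta>\<bar> * (K * k j)"
      using mult_left_mono[OF lam(2)[of j], of "\<bar>\<delta>\<bar>"] abs_le_D1[of "\<delta> * (Re (lam j) + s * (k j)^2)"]
      by (simp add: abs_mult)
    moreover have "\<delta> * (s * (k j)^2) = \<delta>^2 * M / A * k j * k j"
      by (simp add: s power2_eq_square)
    ultimately show ?thesis by (simp add: algebra_simps)
  qed
  then have "filterlim (\<lambda>j. - \<delta> * Re (lam j)) at_top sequentially"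
    by (intro filterlim_at_top_mono[OF lower] always_eventually allI)
  then show ?thesis using lam(1) unfolding \<delta>_def by blast
qed

end
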